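(* Let $X$, $Y$, $\mathcal{B}$, $F$ and the finite-dimensional subspaces $X^\ell\subset X$, $Y^\ell\subset Y$ ($\ell\in\mathbb{N}_0$) with $\dim X^\ell=\dim Y^\ell=N_\ell<\infty$ be as described in the context. Assume that there exists $\bar\gamma$ such that for all $\ell\in\mathbb{N}_0$ $$\inf_{0\ne w\in X^\ell}\ \sup_{0\ne v\in Y^\ell}\frac{\mathcal{B}(w,v)}{\|w\|_X\|v\|_Y}\ge\bar\gamma>0 .$$ Then for every $F\in Y^*$ and every $\ell\in\mathbb{N}$ there is a unique $u^\ell\in X^\ell$ such that $$\mathcal{B}(u^\ell,v^\ell)=F(v^\ell)\qquad\forall v^\ell\in Y^\ell .$$ In particular, the (in general non-symmetric) $N_\ell\times N_\ell$ stiffness matrix of this problem is nonsingular. Moreover, if $u\in X$ is the unique solution of $\mathcal{B}(u,v)=F(v)$ for all $v\in Y$, and $C$ is a constant with $|\mathcal{B}(w,v)|\le C\|w\|_X\|v\|_Y$ for all $w\in X,v\in Y$, then $$\|u-u^\ell\|_X\le\frac{C}{\bar\gamma}\inf_{v^\ell\in X^\ell}\|u-v^\ell\|_X .$$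
   Context: All vector spaces are real, $\mathbb{R}_>=(0,\infty)$. $V\subset H\simeq H^*\subset V^*$ is a Gel'fand triple of separable Hilbert spaces with dense embeddings; $A\in\mathcal{L}(V,V^* )$ is self-adjoint, with form $a(v,w)=\langle Av,w\rangle$ satisfying $a(v,v)\ge\lambda_-\|v\|_V^2$, $|a(v,w)|\le\lambda_+\|v\|_V\|w\|_V$ with $0<\lambda_-\le\lambda_+<\infty$. With $H^1_{0,\{0\}}(\mathbb{R}_>;H)=\{v\in H^1(\mathbb{R}_>;H):v(0)=0\}$ and Hilbert space interpolation $[\cdot,\cdot]_{1/2}$, let $H^{1/2}(\mathbb{R}_>;H)=[L^2(\mathbb{R}_>;H),H^1(\mathbb{R}_>;H)]_{1/2}$, $H^{1/2}_{00,\{0\}}(\mathbb{R}_>;H)=[L^2(\mathbb{R}_>;H),H^1_{0,\{0\}}(\mathbb{R}_>;H)]_{1/2}$, and $X=H^{1/2}_{00,\{0\}}(\mathbb{R}_>;H)\cap L^2(\mathbb{R}_>;V)$, $Y=H^{1/2}(\mathbb{R}_>;H)\cap L^2(\mathbb{R}_>;V)$ with the intersection (Hilbert) norms. The bilinear form is $\mathcal{B}(w,v)=\int_{\mathbb{R}_>}\{(\mathrm{D}_+^{1/2}w,\mathrm{D}_-^{1/2}v)_H+a(w,v)\}\,\mathrm{d}t$ for $w\in X,v\in Y$, where $\mathrm{D}_+^{1/2}:H^{1/2}_{00,\{0\}}(\mathbb{R}_>;H)\to L^2(\mathbb{R}_>;H)$ and $\mathrm{D}_-^{1/2}:H^{1/2}(\mathbb{R}_>;H)\to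 L^2(\mathbb{R}_>;H)$ are the continuous extensions of $(\mathrm{D}_+^{1/2}u)(t)=\Gamma(\frac12)^{-1}\frac{\mathrm{d}}{\mathrm{d}t}\int_0^t(t-s)^{-1/2}u(s)\,\mathrm{d}s$ and $(\mathrm{D}_-^{1/2}u)(t)=-\Gamma(\frac12)^{-1}\frac{\mathrm{d}}{\mathrm{d}t}\int_t^\infty(s-t)^{-1/2}u(s)\,\mathrm{d}s$. It is bounded on $X\times Y$, and for every $F\in Y^*$ the problem $\mathcal{B}(u,v)=F(v)$ for all $v\in Y$ has a unique solution $u\in X$. $\{X^\ell\}_{\ell\in\mathbb{N}_0}$ and $\{Y^\ell\}_{\ell\in\mathbb{N}_0}$ are nested families of subspaces of $X$ and $Y$, respectively, with $\bigcup_\ell X^\ell$ dense in $X$ and $\bigcup_\ell Y^\ell$ dense in $Y$. The stiffness matrix is the matrix of $\mathcal{B}$ restricted to $X^\ell\times Y^\ell$ with respect to chosen bases of these spaces. *)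

theory Defs
  imports "HOL-Analysis.Analysis" "Jordan_Normal_Form.Matrix"
begin

section \<open>The Hilbert space of square integrable functions on the half-line\<close>

definition half_line :: "real measure" where
  "half_line = restrict_space lborel {0<..}"

definition square_integrable :: "(real \<Rightarrow> 'a::{real_inner,second_countable_topology}) \<Rightarrow> bool" where
  "square_integrable f \<longleftrightarrow>
     f \<in> borel_measurable half_line \<and> integrable half_line (\<lambda>t. (norm (f t))\<^sup>2)"

definition L2_eq :: "(real \<Rightarrow> 'a::{real_inner,second_countable_topology}) \<Rightarrow> (real \<Rightarrow> 'a) \<Rightarrow> bool" where
  "L2_eq f g \<longleftrightarrow> square_integrable f \<and> square_integrable g \<and> (AE t in half_line. f t = g t)"

lemma square_integrable_zero: "square_integrable (\<lambda>t. 0)"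
  by (simp add: square_integrable_def)

lemma square_integrable_add:
  assumes "square_integrable f" "square_integrable g"
  shows "square_integrable (\<lambda>t. f t + g t)"
proof -
  have [measurable]: "f \<in> borel_measurable half_line" "g \<in> borel_measurable half_line"
    using assms by (auto simp: square_integrable_def)
  have b: "(norm (x + y))\<^sup>2 \<le> 2 * (norm x)\<^sup>2 + 2 * (norm y)\<^sup>2" for x y :: 'a
  proof -
    have "(norm (x + y))\<^sup>2 \<le> (norm x + norm y)\<^sup>2"
      by (intro power_mono norm_triangle_ineq norm_ge_zero)
    also have "\<dots> \<le> 2 * (norm x)\<^sup>2 + 2 * (norm y)\<^sup>2"
      using sum_squares_bound[of "norm x" "norm y"] by (simp add: power2_sum)
    finally show ?thesis .
  qed
  have "integrable half_line (\<lambda>t. 2 * (norm (f t))\<^sup>2 + 2 * (norm (g t))\<^sup>2)"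
    using assms by (auto simp: square_integrable_def)
  then have "integrable half_line (\<lambda>t. (norm (f t + g t))\<^sup>2)"
    by (rule Bochner_Integration.integrable_bound) (auto intro!: AE_I2 b)
  then show ?thesis
    by (auto simp: square_integrable_def)
qed

lemma square_integrable_scaleR:
  "square_integrable f \<Longrightarrow> square_integrable (\<lambda>t. c *\<^sub>R f t)"
  by (auto simp: square_integrable_def power_mult_distrib)

lemma square_integrable_uminus:
  "square_integrable f \<Longrightarrow> square_integrable (\<lambda>t. - f t)"
  by (auto simp: square_integrable_def)

lemma square_integrable_minus:
  "square_integrable f \<Longrightarrow> square_integrable g \<Longrightarrow> square_integrable (\<lambda>t. f t - g t)"
  using square_integrable_add[of f "\<lambda>t. - g t"] square_integrable_uminus[of g] by simp

lemma square_integrable_inner: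
  assumes "square_integrable f" "square_integrable g"
  shows "integrable half_line (\<lambda>t. inner (f t) (g t))"
proof -
  have [measurable]: "f \<in> borel_measurable half_line" "g \<in> borel_measurable half_line"
    using assms by (auto simp: square_integrable_def)
  have b: "\<bar>inner x y\<bar> \<le> (norm x)\<^sup>2 + (norm y)\<^sup>2" for x y :: 'a
  proof -
    have "\<bar>inner x y\<bar> \<le> norm x * norm y"
      by (rule Cauchy_Schwarz_ineq2)
    also have "\<dots> \<le> (norm x)\<^sup>2 + (norm y)\<^sup>2"
      using sum_squares_bound[of "norm x" "norm y", unfolded mult.assoc]
        mult_nonneg_nonneg[OF norm_ge_zero[of x] norm_ge_zero[of y]]
      by linarith
    finally show ?thesis .
  qed
  have "integrable half_line (\<lambda>t. (norm (f t))\<^sup>2 + (norm (g t))\<^sup>2)"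
    using assms by (auto simp: square_integrable_def)
  then show ?thesis
    by (rule Bochner_Integration.integrable_bound)
       (measurable, simp add: b)
qed

text \<open>Elements of \<open>'a L2\<close> are classes of functions modulo equality almost everywhere on
  \<open>(0, \<infinity>)\<close>; \<open>rep_L2\<close> selects a representative.\<close>

quotient_type (overloaded) 'a L2 =
  "real \<Rightarrow> 'a::{real_inner,second_countable_topology}" / partial: L2_eq
proof (rule part_equivpI)
  show "\<exists>f::real \<Rightarrow> 'a. L2_eq f f"
    by (rule exI[of _ "\<lambda>t. 0"]) (auto simp: L2_eq_def square_integrable_zero)
  show "symp (L2_eq :: (real \<Rightarrow> 'a) \<Rightarrow> _)"
    by (auto simp: symp_def L2_eq_def)
  show "transp (L2_eq :: (real \<Rightarrow> 'a) \<Rightarrow> _)"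
    by (auto simp: transp_def L2_eq_def)
qed

instantiation L2 :: ("{real_inner,second_countable_topology}") real_inner
begin

lift_definition zero_L2 :: "'a L2" is "\<lambda>t. 0"
  by (auto simp: L2_eq_def square_integrable_zero)

lift_definition plus_L2 :: "'a L2 \<Rightarrow> 'a L2 \<Rightarrow> 'a L2" is "\<lambda>f g t. f t + g t"
  by (auto simp: L2_eq_def square_integrable_add)

lift_definition uminus_L2 :: "'a L2 \<Rightarrow> 'a L2" is "\<lambda>f t. - f t"
  by (auto simp: L2_eq_def square_integrable_uminus)

lift_definition minus_L2 :: "'a L2 \<Rightarrow> 'a L2 \<Rightarrow> 'a L2" is "\<lambda>f g t. f t - g t"
  by (auto simp: L2_eq_def square_integrable_minus)

lift_definition scaleR_L2 :: "real \<Rightarrow> 'a L2 \<Rightarrow> 'a L2" is "\<lambda>c f t. c *\<^sub>R f t"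
  by (auto simp: L2_eq_def square_integrable_scaleR)

lift_definition inner_L2 :: "'a L2 \<Rightarrow> 'a L2 \<Rightarrow> real" is
  "\<lambda>f g. \<integral>t. inner (f t) (g t) \<partial>half_line"
  by (rule integral_cong_AE) (auto simp: L2_eq_def square_integrable_def)

definition norm_L2 :: "'a L2 \<Rightarrow> real" where
  "norm_L2 u = sqrt (inner u u)"

definition sgn_L2 :: "'a L2 \<Rightarrow> 'a L2" where
  "sgn_L2 u = inverse (norm u) *\<^sub>R u"

definition dist_L2 :: "'a L2 \<Rightarrow> 'a L2 \<Rightarrow> real" where
  "dist_L2 u v = norm (u - v)"

definition uniformity_L2 :: "('a L2 \<times> 'a L2) filter" where
  "uniformity_L2 = (INF e\<in>{0<..}. principal {(x, y). dist x y < e})"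

definition open_L2 :: "'a L2 set \<Rightarrow> bool" where
  "open_L2 U = (\<forall>x\<in>U. \<forall>\<^sub>F (x', y) in uniformity. x' = x \<longrightarrow> y \<in> U)"

instance
proof
  fix a b :: real and x y z :: "'a L2"
  show "x + y + z = x + (y + z)"
    by transfer (auto simp: L2_eq_def add.assoc square_integrable_add)
  show "x + y = y + x"
    by transfer (simp add: L2_eq_def add.commute square_integrable_add)
  show "0 + x = x"
    by transfer (auto simp: L2_eq_def)
  show "- x + x = 0"
    by transfer (auto simp: L2_eq_def square_integrable_zero)
  show "x - y = x + - y"
    by transfer (auto simp: L2_eq_def square_integrable_minus)
  show "a *\<^sub>R (x + y) = a *\<^sub>R x + a *\<^sub>R y"
    by transfer (auto simp: L2_eq_def scaleR_right_distrib
        intro!: square_integrable_add square_integrable_scaleR)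
  show "(a + b) *\<^sub>R x = a *\<^sub>R x + b *\<^sub>R x"
    by transfer (auto simp: L2_eq_def scaleR_left_distrib
        intro!: square_integrable_add square_integrable_scaleR)
  show "a *\<^sub>R b *\<^sub>R x = (a * b) *\<^sub>R x"
    by transfer (auto simp: L2_eq_def intro!: square_integrable_scaleR)
  show "1 *\<^sub>R x = x"
    by transfer (auto simp: L2_eq_def)
  show "dist x y = norm (x - y)"
    by (rule dist_L2_def)
  show "sgn x = inverse (norm x) *\<^sub>R x"
    by (rule sgn_L2_def)
  show "uniformity = (INF e\<in>{0<..}. principal {(x, y :: 'a L2). dist x y < e})"
    by (rule uniformity_L2_def)
  show "open U = (\<forall>x\<in>U. \<forall>\<^sub>F (x', y) in uniformity. x' = x \<longrightarrow> y \<in> U)" for U :: "'a L2 set"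
    by (rule open_L2_def)
  show "inner x y = inner y x"
    by transfer (simp add: inner_commute)
  show "inner (x + y) z = inner x z + inner y z"
    by transfer (auto simp: L2_eq_def inner_add_left square_integrable_inner)
  show "inner (a *\<^sub>R x) y = a * inner x y"
    by transfer (auto simp: L2_eq_def)
  show "0 \<le> inner x x"
    by transfer auto
  show "inner x x = 0 \<longleftrightarrow> x = 0"
  proof transfer
    fix f :: "real \<Rightarrow> 'a"
    assume "L2_eq f f"
    then have f: "square_integrable f" by (simp add: L2_eq_def)
    have "(\<integral>t. inner (f t) (f t) \<partial>half_line) = 0 \<longleftrightarrow> (AE t in half_line. inner (f t) (f t) = 0)"
      by (rule integral_nonneg_eq_0_iff_AE[OF square_integrable_inner[OF f f]]) auto
    then show "(\<integral>t. inner (f t) (f t) \<partial>half_line) = 0 \<longleftrightarrow> L2_eq f (\<lambda>t. 0)"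
      using f by (simp add: L2_eq_def square_integrable_zero)
  qed
  show "norm x = sqrt (inner x x)"
    by (rule norm_L2_def)
qed

end

definition represents :: "(real \<Rightarrow> 'a::{real_inner,second_countable_topology}) \<Rightarrow> 'a L2 \<Rightarrow> bool" where
  "represents f u \<longleftrightarrow> (AE t in half_line. rep_L2 u t = f t)"


section \<open>Sobolev spaces on the half-line\<close>

definition C1_compact_support :: "real set \<Rightarrow> (real \<Rightarrow> 'a::real_normed_vector) set" where
  "C1_compact_support S =
     {f. f C1_differentiable_on UNIV \<and> (\<exists>K. compact K \<and> K \<subseteq> S \<and> (\<forall>t. t \<notin> K \<longrightarrow> f t = 0))}"

definition has_weak_derivative ::
    "'h::{real_inner,banach,second_countable_topology} L2 \<Rightarrow> 'h L2 \<Rightarrow> bool" where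
  "has_weak_derivative u g \<longleftrightarrow>
     (\<forall>\<phi> \<in> C1_compact_support {0<..}.
        (\<integral>t. deriv \<phi> t *\<^sub>R rep_L2 u t \<partial>half_line) = - (\<integral>t. \<phi> t *\<^sub>R rep_L2 g t \<partial>half_line))"

definition H1 :: "'h::{real_inner,banach,second_countable_topology} L2 set" where
  "H1 = {u. \<exists>g. has_weak_derivative u g}"

definition H1_norm :: "'h::{real_inner,banach,second_countable_topology} L2 \<Rightarrow> real" where
  "H1_norm u = sqrt ((norm u)\<^sup>2 + (norm (THE g. has_weak_derivative u g))\<^sup>2)"

text \<open>The value at \<open>0\<close> of an element of \<open>H1\<close> is that of its representative which is
  continuous up to \<open>0\<close>.\<close>

definition H1_0 :: "'h::{real_inner,banach,second_countable_topology} L2 set" where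
  "H1_0 = {u \<in> H1. \<exists>f. continuous_on {0..} f \<and> represents f u \<and> f 0 = 0}"


section \<open>Hilbert space interpolation\<close>

text \<open>Real interpolation of order \<open>1/2\<close> between the ambient Hilbert space and a subspace \<open>D\<close>
  normed by \<open>N\<close>, by the quadratic \<open>K\<close>-functional.  The integral is that of
  \<open>(s powr (-1/2) * K s u)\<^sup>2\<close> with respect to \<open>ds / s\<close>.  With the factor \<open>2 / pi\<close> the norm equals
  \<open>norm (\<Lambda> powr (1/2) u)\<close>, where \<open>\<Lambda>\<close> is the positive self-adjoint operator
  with domain \<open>D\<close> and \<open>norm (\<Lambda> u) = N u\<close>.\<close>

definition K_functional_sq ::
    "'a::real_normed_vector set \<Rightarrow> ('a \<Rightarrow> real) \<Rightarrow> real \<Rightarrow> 'a \<Rightarrow> real" where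
  "K_functional_sq D N s u = (INF u1\<in>D. (norm (u - u1))\<^sup>2 + s\<^sup>2 * (N u1)\<^sup>2)"

definition interp_half :: "'a::real_normed_vector set \<Rightarrow> ('a \<Rightarrow> real) \<Rightarrow> 'a set" where
  "interp_half D N = {u. integrable half_line (\<lambda>s. K_functional_sq D N s u / s\<^sup>2)}"

definition interp_half_norm ::
    "'a::real_normed_vector set \<Rightarrow> ('a \<Rightarrow> real) \<Rightarrow> 'a \<Rightarrow> real" where
  "interp_half_norm D N u = sqrt (2 / pi * (\<integral>s. K_functional_sq D N s u / s\<^sup>2 \<partial>half_line))"

definition H_half :: "'h::{real_inner,banach,second_countable_topology} L2 set" where
  "H_half = interp_half H1 H1_norm"

definition H_half_norm :: "'h::{real_inner,banach,second_countable_topology} L2 \<Rightarrow> real" where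
  "H_half_norm = interp_half_norm H1 H1_norm"

definition H_half_00 :: "'h::{real_inner,banach,second_countable_topology} L2 set" where
  "H_half_00 = interp_half H1_0 H1_norm"

definition H_half_00_norm :: "'h::{real_inner,banach,second_countable_topology} L2 \<Rightarrow> real" where
  "H_half_00_norm = interp_half_norm H1_0 H1_norm"


section \<open>The spaces \<open>X\<close> and \<open>Y\<close>\<close>

text \<open>The inclusion of \<open>V\<close> into \<open>H\<close> is written as an injection \<open>\<iota> :: 'v \<Rightarrow> 'h\<close>.\<close>

definition L2_V :: "('v::{real_inner,second_countable_topology} \<Rightarrow> 'h) \<Rightarrow>
    'h::{real_inner,second_countable_topology} L2 set" where
  "L2_V \<iota> = {u. \<exists>g. represents (\<lambda>t. \<iota> (rep_L2 g t)) u}"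

definition V_part :: "('v::{real_inner,second_countable_topology} \<Rightarrow> 'h) \<Rightarrow>
    'h::{real_inner,second_countable_topology} L2 \<Rightarrow> 'v L2" where
  "V_part \<iota> u = (THE g. represents (\<lambda>t. \<iota> (rep_L2 g t)) u)"

definition X_space :: "('v::{real_inner,second_countable_topology} \<Rightarrow> 'h) \<Rightarrow>
    'h::{real_inner,banach,second_countable_topology} L2 set" where
  "X_space \<iota> = H_half_00 \<inter> L2_V \<iota>"

definition X_norm :: "('v::{real_inner,second_countable_topology} \<Rightarrow> 'h) \<Rightarrow>
    'h::{real_inner,banach,second_countable_topology} L2 \<Rightarrow> real" where
  "X_norm \<iota> u = sqrt ((H_half_00_norm u)\<^sup>2 + (norm (V_part \<iota> u))\<^sup>2)"

definition Y_space :: "('v::{real_inner,second_countable_topology} \<Rightarrow> 'h) \<Rightarrow>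
    'h::{real_inner,banach,second_countable_topology} L2 set" where
  "Y_space \<iota> = H_half \<inter> L2_V \<iota>"

definition Y_norm :: "('v::{real_inner,second_countable_topology} \<Rightarrow> 'h) \<Rightarrow>
    'h::{real_inner,banach,second_countable_topology} L2 \<Rightarrow> real" where
  "Y_norm \<iota> u = sqrt ((H_half_norm u)\<^sup>2 + (norm (V_part \<iota> u))\<^sup>2)"

text \<open>Bounded linear maps on a subspace \<open>S\<close> with its own norm \<open>N\<close>; values outside \<open>S\<close> are
  irrelevant.\<close>

definition bounded_linear_wrt ::
    "'a::real_vector set \<Rightarrow> ('a \<Rightarrow> real) \<Rightarrow> ('a \<Rightarrow> 'b::real_normed_vector) \<Rightarrow> bool" where
  "bounded_linear_wrt S N f \<longleftrightarrow>
     (\<forall>u\<in>S. \<forall>v\<in>S. f (u + v) = f u + f v) \<and>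
     (\<forall>c. \<forall>u\<in>S. f (c *\<^sub>R u) = c *\<^sub>R f u) \<and>
     (\<exists>M. \<forall>u\<in>S. norm (f u) \<le> M * N u)"

definition dense_wrt :: "'a::real_vector set \<Rightarrow> ('a \<Rightarrow> real) \<Rightarrow> 'a set \<Rightarrow> bool" where
  "dense_wrt S N U \<longleftrightarrow> U \<subseteq> S \<and> (\<forall>u\<in>S. \<forall>e>0. \<exists>v\<in>U. N (u - v) < e)"


section \<open>Half-order derivatives and the space-time bilinear form\<close>

definition RL_deriv_plus ::
    "(real \<Rightarrow> 'h::{real_inner,banach,second_countable_topology}) \<Rightarrow> real \<Rightarrow> 'h" where
  "RL_deriv_plus f t = (1 / Gamma (1/2)) *\<^sub>R
     vector_derivative (\<lambda>r. LINT s:{0..r}|lborel. (r - s) powr (-1/2) *\<^sub>R f s) (at t)"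

definition RL_deriv_minus ::
    "(real \<Rightarrow> 'h::{real_inner,banach,second_countable_topology}) \<Rightarrow> real \<Rightarrow> 'h" where
  "RL_deriv_minus f t = - (1 / Gamma (1/2)) *\<^sub>R
     vector_derivative (\<lambda>r. LINT s:{r..}|lborel. (s - r) powr (-1/2) *\<^sub>R f s) (at t)"

text \<open>The continuous extensions, characterised by their values on dense subspaces: compactly
  supported functions on \<open>(0, \<infinity>)\<close>, respectively restrictions to \<open>(0, \<infinity>)\<close> of compactly supported
  functions on the real line.\<close>

definition is_half_deriv_plus ::
    "('h::{real_inner,banach,second_countable_topology} L2 \<Rightarrow> 'h L2) \<Rightarrow> bool" where
  "is_half_deriv_plus D \<longleftrightarrow>
     bounded_linear_wrt H_half_00 H_half_00_norm D \<and>
     (\<forall>f \<in> C1_compact_support {0<..}. \<forall>u. represents f u \<longrightarrow> represents (RL_deriv_plus f) (D u))"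

definition is_half_deriv_minus ::
    "('h::{real_inner,banach,second_countable_topology} L2 \<Rightarrow> 'h L2) \<Rightarrow> bool" where
  "is_half_deriv_minus D \<longleftrightarrow>
     bounded_linear_wrt H_half H_half_norm D \<and>
     (\<forall>f \<in> C1_compact_support UNIV. \<forall>u. represents f u \<longrightarrow> represents (RL_deriv_minus f) (D u))"

definition bilinear_form ::
    "('v::{real_inner,banach,second_countable_topology} \<Rightarrow> 'h) \<Rightarrow> ('v \<Rightarrow>\<^sub>L 'v \<Rightarrow>\<^sub>L real) \<Rightarrow>
     ('h L2 \<Rightarrow> 'h L2) \<Rightarrow> ('h L2 \<Rightarrow> 'h L2) \<Rightarrow>
     'h::{real_inner,banach,second_countable_topology} L2 \<Rightarrow> 'h L2 \<Rightarrow> real" where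
  "bilinear_form \<iota> A Dp Dm w v =
     (\<integral>t. inner (rep_L2 (Dp w) t) (rep_L2 (Dm v) t)
           + blinfun_apply (blinfun_apply A (rep_L2 (V_part \<iota> w) t)) (rep_L2 (V_part \<iota> v) t)
      \<partial>half_line)"


section \<open>Bases and the stiffness matrix\<close>

definition is_basis :: "nat \<Rightarrow> (nat \<Rightarrow> 'a::real_vector) \<Rightarrow> 'a set \<Rightarrow> bool" where
  "is_basis n b U \<longleftrightarrow> inj_on b {..<n} \<and> independent (b ` {..<n}) \<and> span (b ` {..<n}) = U"

definition stiffness_matrix ::
    "nat \<Rightarrow> ('a \<Rightarrow> 'b \<Rightarrow> real) \<Rightarrow> (nat \<Rightarrow> 'a) \<Rightarrow> (nat \<Rightarrow> 'b) \<Rightarrow> real mat" where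
  "stiffness_matrix n B \<phi> \<psi> = Matrix.mat n n (\<lambda>(i, j). B (\<phi> j) (\<psi> i))"

end

(*
  The inf-sup condition makes the map from X^l to the dual of Y^l induced by the bilinear form
  injective, and dim X^l = dim Y^l makes it bijective.

  The constant C / gamma, instead of 1 + C / gamma, uses that the norm of X is a Hilbert norm.  If
  ul is the Galerkin solution, v lies in X^l, p = ul - v and q = u - ul, then Galerkin orthogonality
  and the inf-sup condition give gamma |s p| <= C |s p + t q| for all real s, t.  For s = |q| / |p| and
  t = 1 / s the polarisation identity yields |s p| = |q| and |s p + t q| = |p + q| = |u - v|.

  That the norm of X is a Hilbert norm amounts to the parallelogram law for the H^1 norm, which
  passes to the K-functional, an infimum over a subspace, and to its integral.  The law for the H^1
  norm needs the uniqueness of weak derivatives.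

  If X^l = {0}, the condition at level l gives no lower bound for C; then C >= gamma comes from
  another level, or, if all X^l are {0}, density makes the norm of X vanish.
*)
theory Submission
  imports Defs "Jordan_Normal_Form.Determinant"
begin

section \<open>Quadratic forms and the parallelogram law\<close>

text \<open>Squares of seminorms that come from a semi-inner product, described by the parallelogram
  law: \<open>X_norm\<close> is built from infima and integrals, through which the law passes more
  easily than an inner product.\<close>

definition nonneg_quadratic_on :: "'a::real_vector set \<Rightarrow> ('a \<Rightarrow> real) \<Rightarrow> bool" where
  "nonneg_quadratic_on S q \<longleftrightarrow>
     (\<forall>u\<in>S. 0 \<le> q u) \<and> (\<forall>c. \<forall>u\<in>S. q (c *\<^sub>R u) = c\<^sup>2 * q u) \<and>
     (\<forall>u\<in>S. \<forall>v\<in>S. q (u + v) + q (u - v) = 2 * q u + 2 * q v)"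

lemma nonneg_quadratic_onD:
  assumes "nonneg_quadratic_on S q"
  shows "u \<in> S \<Longrightarrow> 0 \<le> q u"
    and "u \<in> S \<Longrightarrow> q (c *\<^sub>R u) = c\<^sup>2 * q u"
    and "u \<in> S \<Longrightarrow> v \<in> S \<Longrightarrow> q (u + v) + q (u - v) = 2 * q u + 2 * q v"
  using assms by (auto simp: nonneg_quadratic_on_def)

text \<open>The inequalities reverse themselves: scaling is applied to \<open>c *\<^sub>R u\<close>
  with factor \<open>inverse c\<close>, and the parallelogram inequality to \<open>u + v\<close> and
  \<open>u - v\<close>, whose sum and difference are \<open>2 *\<^sub>R u\<close> and
  \<open>2 *\<^sub>R v\<close>.\<close>

lemma nonneg_quadratic_onI_le:
  fixes q :: "'a::real_vector \<Rightarrow> real"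
  assumes S: "subspace S"
    and nonneg: "\<And>u. u \<in> S \<Longrightarrow> 0 \<le> q u"
    and scale: "\<And>c u. u \<in> S \<Longrightarrow> q (c *\<^sub>R u) \<le> c\<^sup>2 * q u"
    and par: "\<And>u v. u \<in> S \<Longrightarrow> v \<in> S \<Longrightarrow> q (u + v) + q (u - v) \<le> 2 * q u + 2 * q v"
  shows "nonneg_quadratic_on S q"
proof -
  have eq: "q (c *\<^sub>R u) = c\<^sup>2 * q u" if u: "u \<in> S" for c u
  proof (cases "c = 0")
    case True
    then show ?thesis
      using scale[OF u, of c] nonneg[of "c *\<^sub>R u"] subspace_0[OF S] by auto
  next
    case False
    have "q u = q (inverse c *\<^sub>R (c *\<^sub>R u))" using False by simp
    also have "\<dots> \<le> (inverse c)\<^sup>2 * q (c *\<^sub>R u)"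
      by (rule scale) (use S u in \<open>simp add: subspace_scale\<close>)
    finally have "c\<^sup>2 * q u \<le> c\<^sup>2 * ((inverse c)\<^sup>2 * q (c *\<^sub>R u))"
      by (rule mult_left_mono) simp
    also have "\<dots> = q (c *\<^sub>R u)" using False by (simp add: field_simps)
    finally show ?thesis using scale[OF u, of c] by simp
  qed
  have "2 * q u + 2 * q v \<le> q (u + v) + q (u - v)" if u: "u \<in> S" and v: "v \<in> S" for u v
  proof -
    have e: "(u + v) + (u - v) = 2 *\<^sub>R u" "(u + v) - (u - v) = 2 *\<^sub>R v"
      by (simp_all add: scaleR_2)
    show ?thesis
      using par[of "u + v" "u - v"] eq[OF u, of 2] eq[OF v, of 2] S u v
      unfolding e by (simp add: subspace_add subspace_diff)
  qed
  then show ?thesis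
    unfolding nonneg_quadratic_on_def using nonneg eq par by (auto intro!: antisym)
qed

lemma nonneg_quadratic_on_subset:
  "nonneg_quadratic_on S q \<Longrightarrow> T \<subseteq> S \<Longrightarrow> nonneg_quadratic_on T q"
  by (auto simp: nonneg_quadratic_on_def subset_iff)

lemma nonneg_quadratic_on_add:
  assumes "nonneg_quadratic_on S p" "nonneg_quadratic_on S q"
  shows "nonneg_quadratic_on S (\<lambda>u. p u + q u)"
proof -
  have "p (u + v) + q (u + v) + (p (u - v) + q (u - v)) = 2 * (p u + q u) + 2 * (p v + q v)"
    if "u \<in> S" "v \<in> S" for u v
    using nonneg_quadratic_onD(3)[OF assms(1) that] nonneg_quadratic_onD(3)[OF assms(2) that]
    by argo
  then show ?thesis
    using assms unfolding nonneg_quadratic_on_def by (simp add: distrib_left)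
qed

lemma nonneg_quadratic_on_cmult:
  assumes q: "nonneg_quadratic_on S q" and c: "0 \<le> c"
  shows "nonneg_quadratic_on S (\<lambda>u. c * q u)"
  unfolding nonneg_quadratic_on_def
proof (intro conjI ballI allI)
  show "0 \<le> c * q u" if "u \<in> S" for u
    using c nonneg_quadratic_onD(1)[OF q that] by simp
  show "c * q (d *\<^sub>R u) = d\<^sup>2 * (c * q u)" if "u \<in> S" for d u
    unfolding nonneg_quadratic_onD(2)[OF q that] by (rule mult.left_commute)
  show "c * q (u + v) + c * q (u - v) = 2 * (c * q u) + 2 * (c * q v)" if "u \<in> S" "v \<in> S" for u v
    using arg_cong[OF nonneg_quadratic_onD(3)[OF q that], of "\<lambda>x. c * x"]
    by (simp add: distrib_left mult.left_commute[of c])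
qed

text \<open>Pulls the parallelogram law back along maps whose linearity is known only on a subspace,
  such as \<open>V_part\<close> and the weak derivative.\<close>

lemma nonneg_quadratic_on_norm_sq:
  fixes f :: "'a::real_vector \<Rightarrow> 'b::real_inner"
  assumes S: "subspace S"
    and "\<And>u v. u \<in> S \<Longrightarrow> v \<in> S \<Longrightarrow> f (u + v) = f u + f v"
    and sc: "\<And>c u. u \<in> S \<Longrightarrow> f (c *\<^sub>R u) = c *\<^sub>R f u"
  shows "nonneg_quadratic_on S (\<lambda>u. (norm (f u))\<^sup>2)"
proof -
  have diff: "f (u - v) = f u - f v" if "u \<in> S" "v \<in> S" for u v
    using assms(2)[of u "- v"] sc[of v "-1"] subspace_neg[OF S] that by simp
  have "(norm (f (u + v)))\<^sup>2 + (norm (f (u - v)))\<^sup>2 = 2 * (norm (f u))\<^sup>2 + 2 * (norm (f v))\<^sup>2"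
    if "u \<in> S" "v \<in> S" for u v
    using that by (simp add: assms(2) diff power2_norm_eq_inner inner_simps inner_commute)
  then show ?thesis
    using sc unfolding nonneg_quadratic_on_def by (simp add: power_mult_distrib)
qed

text \<open>Competitors \<open>d\<close> for \<open>u\<close> and \<open>e\<close> for
  \<open>v\<close> yield the competitors \<open>d + e\<close> for \<open>u + v\<close> and
  \<open>d - e\<close> for \<open>u - v\<close>. The squared K-functional is an infimum of this
  kind.\<close>

lemma nonneg_quadratic_on_INF:
  assumes S: "subspace S" and D: "subspace D"
    and p: "nonneg_quadratic_on (UNIV :: 'a::real_vector set) p"
    and q: "nonneg_quadratic_on D q"
  shows "nonneg_quadratic_on S (\<lambda>u. INF d\<in>D. p (u - d) + q d)"
proof -
  let ?K = "\<lambda>u. INF d\<in>D. p (u - d) + q d"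
  have ne: "D \<noteq> {}" using subspace_0[OF D] by auto
  have nn: "0 \<le> p (u - d) + q d" if "d \<in> D" for u d
    using nonneg_quadratic_onD(1)[OF p] nonneg_quadratic_onD(1)[OF q that] by (simp add: add_nonneg_nonneg)
  have bdd: "bdd_below ((\<lambda>d. p (u - d) + q d) ` D)" for u
    using nn by (auto intro!: bdd_belowI)
  have low: "?K u \<le> p (u - d) + q d" if "d \<in> D" for u d
    by (rule cINF_lower[OF bdd that])
  show ?thesis
  proof (rule nonneg_quadratic_onI_le[OF S])
    show "0 \<le> ?K u" for u by (rule cINF_greatest[OF ne nn])
  next
    fix c u
    have *: "?K (c *\<^sub>R u) \<le> c\<^sup>2 * (p (u - d) + q d)" if d: "d \<in> D" for d
    proof -
      have "?K (c *\<^sub>R u) \<le> p (c *\<^sub>R u - c *\<^sub>R d) + q (c *\<^sub>R d)"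
        by (rule low[OF subspace_scale[OF D d]])
      also have "\<dots> = c\<^sup>2 * (p (u - d) + q d)"
        using nonneg_quadratic_onD(2)[OF p, of "u - d" c] nonneg_quadratic_onD(2)[OF q d, of c]
        by (simp add: scaleR_diff_right distrib_left)
      finally show ?thesis .
    qed
    show "?K (c *\<^sub>R u) \<le> c\<^sup>2 * ?K u"
    proof (cases "c = 0")
      case True
      then show ?thesis using *[OF subspace_0[OF D]] by simp
    next
      case False
      have "?K (c *\<^sub>R u) / c\<^sup>2 \<le> ?K u"
        by (rule cINF_greatest[OF ne]) (use * False in \<open>simp add: field_simps\<close>)
      then show ?thesis using False by (simp add: field_simps)
    qed
  next
    fix u v
    have *: "?K (u + v) + ?K (u - v) \<le> 2 * (p (u - d) + q d) + 2 * (p (v - e) + q e)"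
      if d: "d \<in> D" and e: "e \<in> D" for d e
    proof -
      have "?K (u + v) \<le> p ((u - d) + (v - e)) + q (d + e)"
        using low[OF subspace_add[OF D d e], of "u + v"] by (simp add: algebra_simps)
      moreover have "?K (u - v) \<le> p ((u - d) - (v - e)) + q (d - e)"
        using low[OF subspace_diff[OF D d e], of "u - v"] by (simp add: algebra_simps)
      moreover note nonneg_quadratic_onD(3)[OF p, of "u - d" "v - e"]
        nonneg_quadratic_onD(3)[OF q d e]
      ultimately show ?thesis by simp
    qed
    \<comment> \<open>The infima over \<open>e\<close> and over \<open>d\<close> are taken one after
      the other, with all remaining terms on the left.\<close>
    have **: "?K (u + v) + ?K (u - v) - 2 * (p (u - d) + q d) \<le> 2 * ?K v" if d: "d \<in> D" for d
    proof -
      have "(?K (u + v) + ?K (u - v) - 2 * (p (u - d) + q d)) / 2 \<le> ?K v"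
      proof (rule cINF_greatest[OF ne])
        fix e assume "e \<in> D"
        from *[OF d this]
        show "(?K (u + v) + ?K (u - v) - 2 * (p (u - d) + q d)) / 2 \<le> p (v - e) + q e" by argo
      qed
      then show ?thesis by argo
    qed
    have "(?K (u + v) + ?K (u - v) - 2 * ?K v) / 2 \<le> ?K u"
    proof (rule cINF_greatest[OF ne])
      fix d assume "d \<in> D"
      from **[OF this]
      show "(?K (u + v) + ?K (u - v) - 2 * ?K v) / 2 \<le> p (u - d) + q d" by argo
    qed
    then show "?K (u + v) + ?K (u - v) \<le> 2 * ?K u + 2 * ?K v" by argo
  qed
qed

section \<open>From the parallelogram law to polarisation\<close>

text \<open>The defect \<open>h s = g s - s * g 1\<close> is additive and vanishes at the integers,
  so it has period 1 and is bounded everywhere. As \<open>h (n * s) = n * h s\<close>, it must be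
  0.\<close>

lemma additive_bounded_imp_linear:
  fixes g :: "real \<Rightarrow> real"
  assumes add: "\<And>s t. g (s + t) = g s + g t"
    and bound: "\<And>s. 0 \<le> s \<Longrightarrow> s \<le> 1 \<Longrightarrow> \<bar>g s\<bar> \<le> M"
  shows "g s = s * g 1"
proof -
  define h where "h s = g s - s * g 1" for s
  have h_add: "h (s + t) = h s + h t" for s t
    by (simp add: h_def add algebra_simps)
  have h_nat: "h (real n * s) = real n * h s" for n s
  proof (induction n)
    case 0
    then show ?case using h_add[of 0 0] by simp
  next
    case (Suc n)
    then show ?case using h_add[of s "real n * s"] by (simp add: algebra_simps)
  qed
  have h1: "h 1 = 0" by (simp add: h_def)
  have h_neg: "h (- s) = - h s" for s
    using h_add[of s "- s"] h_nat[of 0 0] by simp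
  have h_int: "h (of_int k) = 0" for k
    using h_nat[of "nat k" 1] h_nat[of "nat (- k)" 1] h1 h_neg[of "of_int k"]
    by (cases "0 \<le> k") auto
  have bnd: "\<bar>h s\<bar> \<le> M + \<bar>g 1\<bar>" for s
  proof -
    have "h s = h (frac s)"
      using h_add[of "frac s" "of_int \<lfloor>s\<rfloor>"] h_int by (simp add: frac_def)
    moreover have "\<bar>h (frac s)\<bar> \<le> \<bar>g (frac s)\<bar> + \<bar>frac s * g 1\<bar>"
      unfolding h_def by (rule abs_triangle_ineq4)
    moreover have "\<bar>g (frac s)\<bar> \<le> M"
      using bound[of "frac s"] frac_lt_1[of s] by simp
    moreover have "\<bar>frac s * g 1\<bar> \<le> \<bar>g 1\<bar>"
      using frac_lt_1[of s] by (simp add: abs_mult mult_left_le_one_le)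
    ultimately show ?thesis by linarith
  qed
  have "h s = 0"
  proof (rule ccontr)
    assume "h s \<noteq> 0"
    then obtain n where "M + \<bar>g 1\<bar> < real n * \<bar>h s\<bar>"
      using reals_Archimedean3[of "\<bar>h s\<bar>"] by auto
    with bnd[of "real n * s"] show False by (simp add: h_nat abs_mult)
  qed
  then show ?thesis by (simp add: h_def)
qed

text \<open>Jordan--von Neumann: the parallelogram law makes the polarisation biadditive, and
  nonnegativity makes it bounded along lines, hence bilinear.\<close>

lemma nonneg_quadratic_on_combination:
  assumes S: "subspace S" and q: "nonneg_quadratic_on S q" and x: "x \<in> S" and y: "y \<in> S"
  shows "q (s *\<^sub>R x + t *\<^sub>R y) = s\<^sup>2 * q x + t\<^sup>2 * q y + s * t * (q (x + y) - q x - q y)"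
proof -
  note [intro] = subspace_add[OF S] subspace_diff[OF S] subspace_scale[OF S]
  note nn = nonneg_quadratic_onD(1)[OF q] and sc = nonneg_quadratic_onD(2)[OF q]
    and par = nonneg_quadratic_onD(3)[OF q]
  \<comment> \<open>This is additivity of the polarisation \<open>b\<close> below in its first
    argument. Of the four instances of \<open>par\<close>, the first two minus the third give it
    once the fourth has eliminated \<open>q (y - z)\<close>.\<close>
  have three: "q (x + y + z) + q x + q y + q z = q (x + y) + q (y + z) + q (x + z)"
    if xyz: "x \<in> S" "y \<in> S" "z \<in> S" for x y z
  proof -
    have e: "x + z + y = x + y + z" "x + (y - z) = x + y - z" "x - (y - z) = x + z - y"
      by (simp_all add: algebra_simps)
    have "q (x + y + z) + q (x + y - z) = 2 * q (x + y) + 2 * q z"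
      using xyz by (intro par) auto
    moreover have "q (x + y + z) + q (x + z - y) = 2 * q (x + z) + 2 * q y"
      using xyz par[of "x + z" y] unfolding e by auto
    moreover have "q (x + y - z) + q (x + z - y) = 2 * q x + 2 * q (y - z)"
      using xyz par[of x "y - z"] unfolding e by auto
    moreover have "q (y + z) + q (y - z) = 2 * q y + 2 * q z"
      using xyz by (intro par) auto
    ultimately show ?thesis by argo
  qed
  define b where "b x y = q (x + y) - q x - q y" for x y
  have b_scale: "b (s *\<^sub>R x) y = s * b x y" if x: "x \<in> S" and y: "y \<in> S" for s x y
  proof -
    have add: "b ((s + t) *\<^sub>R x) y = b (s *\<^sub>R x) y + b (t *\<^sub>R x) y" for s t
      using three[OF subspace_scale[OF S x] subspace_scale[OF S x] y, of s t]
      by (simp add: b_def scaleR_left_distrib)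
    \<comment> \<open>By \<open>par\<close> and nonnegativity, \<open>q (s *\<^sub>R x + y)\<close>
      lies between 0 and twice \<open>q (s *\<^sub>R x) + q y\<close>; subtracting that sum centres
      the interval at 0.\<close>
    have bound: "\<bar>b (s *\<^sub>R x) y\<bar> \<le> q x + q y" if "0 \<le> s" "s \<le> 1" for s
    proof -
      have "q (s *\<^sub>R x + y) + q (s *\<^sub>R x - y) = 2 * q (s *\<^sub>R x) + 2 * q y"
        using x y by (intro par) auto
      moreover have "0 \<le> q (s *\<^sub>R x + y)" "0 \<le> q (s *\<^sub>R x - y)"
        using x y by (auto intro!: nn)
      ultimately have "\<bar>b (s *\<^sub>R x) y\<bar> \<le> q (s *\<^sub>R x) + q y"
        unfolding b_def by linarith
      also have "q (s *\<^sub>R x) \<le> q x"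
        using that nn[OF x] sc[OF x] by (simp add: mult_left_le_one_le power_le_one)
      finally show ?thesis by simp
    qed
    have "b (s *\<^sub>R x) y = s * b (1 *\<^sub>R x) y"
      by (rule additive_bounded_imp_linear[where g = "\<lambda>s. b (s *\<^sub>R x) y", OF add bound])
    then show ?thesis by simp
  qed
  have b_sym: "b x y = b y x" for x y by (simp add: b_def add.commute)
  have "b (s *\<^sub>R x) (t *\<^sub>R y) = s * (t * b x y)"
    using b_scale[OF x subspace_scale[OF S y], of s t] b_scale[OF y x, of t]
    by (simp add: b_sym[of x])
  then show ?thesis
    using sc[OF x] sc[OF y] by (simp add: b_def algebra_simps)
qed

section \<open>Petrov--Galerkin problems in finite dimension\<close>

text \<open>Relative to subsets, because \<open>bilinear_form\<close> is made of
  \<open>V_part\<close>, \<open>Dp\<close> and \<open>Dm\<close>, whose linearity is known only on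
  their subspaces.\<close>

definition bilinear_on ::
    "'a::real_vector set \<Rightarrow> 'b::real_vector set \<Rightarrow> ('a \<Rightarrow> 'b \<Rightarrow> real) \<Rightarrow> bool" where
  "bilinear_on X Y B \<longleftrightarrow>
     (\<forall>u\<in>X. \<forall>v\<in>X. \<forall>y\<in>Y. B (u + v) y = B u y + B v y) \<and>
     (\<forall>c. \<forall>u\<in>X. \<forall>y\<in>Y. B (c *\<^sub>R u) y = c * B u y) \<and>
     (\<forall>x\<in>X. \<forall>u\<in>Y. \<forall>v\<in>Y. B x (u + v) = B x u + B x v) \<and>
     (\<forall>c. \<forall>x\<in>X. \<forall>u\<in>Y. B x (c *\<^sub>R u) = c * B x u)"

lemma bilinear_onD:
  assumes "bilinear_on X Y B"
  shows "u \<in> X \<Longrightarrow> v \<in> X \<Longrightarrow> y \<in> Y \<Longrightarrow> B (u + v) y = B u y + B v y"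
    and "u \<in> X \<Longrightarrow> y \<in> Y \<Longrightarrow> B (c *\<^sub>R u) y = c * B u y"
    and "x \<in> X \<Longrightarrow> y \<in> Y \<Longrightarrow> y' \<in> Y \<Longrightarrow> B x (y + y') = B x y + B x y'"
    and "x \<in> X \<Longrightarrow> y \<in> Y \<Longrightarrow> B x (c *\<^sub>R y) = c * B x y"
  using assms by (auto simp: bilinear_on_def)

lemma bilinear_on_subset:
  "bilinear_on X Y B \<Longrightarrow> U \<subseteq> X \<Longrightarrow> W \<subseteq> Y \<Longrightarrow> bilinear_on U W B"
  unfolding bilinear_on_def by (meson subsetD)

lemma additive_on_sum:
  fixes f :: "'a::real_vector \<Rightarrow> 'b::real_vector"
  assumes S: "subspace S"
    and add: "\<And>u v. u \<in> S \<Longrightarrow> v \<in> S \<Longrightarrow> f (u + v) = f u + f v"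
    and sc: "\<And>c u. u \<in> S \<Longrightarrow> f (c *\<^sub>R u) = c *\<^sub>R f u"
    and b: "\<And>i. i \<in> I \<Longrightarrow> b i \<in> S" and fin: "finite I"
  shows "f (\<Sum>i\<in>I. c i *\<^sub>R b i) = (\<Sum>i\<in>I. c i *\<^sub>R f (b i))"
  using fin b
proof (induction I)
  case empty
  show ?case using sc[OF subspace_0[OF S], of 0] by simp
next
  case (insert i I)
  then show ?case
    using S by (simp add: add sc subspace_scale subspace_sum)
qed

lemma additive_on_eq_span:
  fixes f g :: "'a::real_vector \<Rightarrow> real"
  assumes W: "W = span b"
    and f: "\<And>u v. u \<in> W \<Longrightarrow> v \<in> W \<Longrightarrow> f (u + v) = f u + f v" "\<And>c u. u \<in> W \<Longrightarrow> f (c *\<^sub>R u) = c * f u"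
    and g: "\<And>u v. u \<in> W \<Longrightarrow> v \<in> W \<Longrightarrow> g (u + v) = g u + g v" "\<And>c u. u \<in> W \<Longrightarrow> g (c *\<^sub>R u) = c * g u"
    and eq: "\<And>x. x \<in> b \<Longrightarrow> f x = g x" and w: "w \<in> W"
  shows "f w = g w"
proof -
  have "w \<in> span b" using w W by simp
  then have "w \<in> W \<and> f w = g w"
  proof (induction rule: span_induct_alt)
    case base
    show ?case using f(2)[of 0 0] g(2)[of 0 0] W by (simp add: span_zero)
  next
    case (step c x y)
    then show ?case
      using W by (simp add: f g eq span_base span_scale span_add)
  qed
  then show ?thesis ..
qed

section \<open>Indexed bases, the stiffness matrix and unique solvability\<close>

lemma is_basis_exists:
  assumes fin: "finite b" and span: "span b = U" and dim: "dim U = n"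
  shows "\<exists>\<phi>. is_basis n \<phi> U"
proof -
  obtain B where B: "B \<subseteq> U" "independent B" "U \<subseteq> span B" "card B = n"
    using basis_exists[of U] dim by metis
  \<comment> \<open>\<open>card B = n\<close> alone does not make \<open>B\<close> finite, since
    infinite sets have \<open>card\<close> 0; the finite spanning set does.\<close>
  have "finite B"
    using independent_span_bound[OF fin B(2)] B(1) span by auto
  then obtain \<phi> where "bij_betw \<phi> {..<n} B"
    using ex_bij_betw_nat_finite[of B] B(4) by (auto simp: atLeast0LessThan)
  moreover have "span B = U"
    using B(1,3) span_minimal[OF B(1)] span subspace_span by blast
  ultimately show ?thesis
    using B(2) unfolding is_basis_def bij_betw_def by metis
qed

lemma invertible_mat_if_det_nonzero:
  fixes A :: "'a::field mat"
  assumes A: "A \<in> carrier_mat n n" and det: "det A \<noteq> 0"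
  shows "invertible_mat A"
proof -
  obtain C where "C \<in> carrier_mat n n" "C * A = 1\<^sub>m n" "A * C = 1\<^sub>m n"
    using det_non_zero_imp_unit[OF A det, of "()"] unfolding Units_def ring_mat_def by auto
  then show ?thesis
    using A unfolding invertible_mat_def inverts_mat_def by auto
qed

lemma is_basisD:
  assumes "is_basis n \<phi> U"
  shows "U = span (\<phi> ` {..<n})" and "subspace U" and "j < n \<Longrightarrow> \<phi> j \<in> U"
    and "(\<Sum>j<n. c j *\<^sub>R \<phi> j) \<in> U"
proof -
  show *: "U = span (\<phi> ` {..<n})" using assms by (simp add: is_basis_def)
  show "subspace U" unfolding * by (rule subspace_span)
  show "\<phi> j \<in> U" if "j < n" for j unfolding * using that by (intro span_base) auto
  show "(\<Sum>j<n. c j *\<^sub>R \<phi> j) \<in> U"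
    unfolding * by (intro span_sum span_scale span_base) auto
qed

text \<open>Translates linear systems into statements about \<open>B\<close>: columns belong to
  trial functions, rows to test functions.\<close>

lemma stiffness_matrix_mult_vec:
  assumes B: "bilinear_on U W B" and U: "is_basis n \<phi> U" and W: "is_basis n \<psi> W"
    and c: "c \<in> carrier_vec n" and i: "i < n"
  shows "vec_index (stiffness_matrix n B \<phi> \<psi> *\<^sub>v c) i = B (\<Sum>j<n. vec_index c j *\<^sub>R \<phi> j) (\<psi> i)"
proof -
  have "B (\<Sum>j<n. vec_index c j *\<^sub>R \<phi> j) (\<psi> i) = (\<Sum>j<n. vec_index c j *\<^sub>R B (\<phi> j) (\<psi> i))"
    by (rule additive_on_sum[where f = "\<lambda>w. B w (\<psi> i)", OF is_basisD(2)[OF U]])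
       (use is_basisD(3)[OF U] is_basisD(3)[OF W i] in \<open>auto simp: bilinear_onD[OF B]\<close>)
  then show ?thesis
    using c i by (simp add: stiffness_matrix_def scalar_prod_def mult.commute atLeast0LessThan)
qed

text \<open>A zero determinant gives a nonzero kernel vector \<open>c\<close>. The element of
  \<open>U\<close> with coefficients \<open>c\<close> is annihilated by a basis of \<open>W\<close>,
  hence by \<open>W\<close>, so it is 0 by \<open>inj\<close>, and independence of the basis
  contradicts \<open>c\<close> being nonzero.\<close>

lemma stiffness_matrix_invertible:
  assumes B: "bilinear_on U W B" and U: "is_basis n \<phi> U" and W: "is_basis n \<psi> W"
    and inj: "\<And>w. w \<in> U \<Longrightarrow> (\<And>v. v \<in> W \<Longrightarrow> B w v = 0) \<Longrightarrow> w = 0"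
  shows "invertible_mat (stiffness_matrix n B \<phi> \<psi>)"
proof (rule invertible_mat_if_det_nonzero)
  let ?S = "stiffness_matrix n B \<phi> \<psi>"
  show S: "?S \<in> carrier_mat n n" by (simp add: stiffness_matrix_def)
  show "det ?S \<noteq> 0"
  proof
    assume "det ?S = 0"
    then obtain c where c: "c \<in> carrier_vec n" "c \<noteq> 0\<^sub>v n" "?S *\<^sub>v c = 0\<^sub>v n"
      using det_0_iff_vec_prod_zero_field[OF S] by auto
    define w where "w = (\<Sum>j<n. vec_index c j *\<^sub>R \<phi> j)"
    have wU: "w \<in> U" unfolding w_def by (rule is_basisD(4)[OF U])
    have on_basis: "B w (\<psi> i) = 0" if "i < n" for i
      using stiffness_matrix_mult_vec[OF B U W c(1) that] c(3) that by (simp add: w_def)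
    have "B w v = 0" if "v \<in> W" for v
      by (rule additive_on_eq_span[OF is_basisD(1)[OF W], of "B w" "\<lambda>_. 0"])
         (auto simp: bilinear_onD(3,4)[OF B wU] on_basis that)
    then have "w = 0" by (rule inj[OF wU])
    \<comment> \<open>\<open>independentD\<close> concerns sums over a set of vectors, so the sum is
      reindexed by the inverse of the injective family \<open>\<phi>\<close>.\<close>
    then have "(\<Sum>v\<in>\<phi> ` {..<n}. vec_index c (the_inv_into {..<n} \<phi> v) *\<^sub>R v) = 0"
      using U unfolding w_def is_basis_def
      by (subst sum.reindex) (auto simp: the_inv_into_f_f intro!: sum.cong)
    then have "vec_index c (the_inv_into {..<n} \<phi> (\<phi> j)) = 0" if "j < n" for j
      using U that unfolding is_basis_def
      by (intro independentD[of "\<phi> ` {..<n}" "\<phi> ` {..<n}" "\<lambda>v. vec_index c (the_inv_into {..<n} \<phi> v)"])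
         auto
    then have "vec_index c j = 0" if "j < n" for j
      using U that unfolding is_basis_def by (simp add: the_inv_into_f_f)
    then have "c = 0\<^sub>v n" using c(1) by (intro eq_vecI) auto
    with c(2) show False ..
  qed
qed

text \<open>Equal dimensions make the matrix square, so \<open>inj\<close> yields a right inverse
  and with it existence. Uniqueness follows from \<open>inj\<close> directly.\<close>

lemma galerkin_unique_solution:
  assumes B: "bilinear_on U W B"
    and U: "finite b" "span b = U" "dim U = n" and W: "finite d" "span d = W" "dim W = n"
    and inj: "\<And>w. w \<in> U \<Longrightarrow> (\<And>v. v \<in> W \<Longrightarrow> B w v = 0) \<Longrightarrow> w = 0"
    and F: "\<And>u v. u \<in> W \<Longrightarrow> v \<in> W \<Longrightarrow> F (u + v) = F u + F v"
      "\<And>c u. u \<in> W \<Longrightarrow> F (c *\<^sub>R u) = c * F u"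
  shows "\<exists>!u. u \<in> U \<and> (\<forall>v\<in>W. B u v = F v)"
proof -
  obtain \<phi> \<psi> where \<phi>: "is_basis n \<phi> U" and \<psi>: "is_basis n \<psi> W"
    using is_basis_exists[OF U] is_basis_exists[OF W] by auto
  let ?S = "stiffness_matrix n B \<phi> \<psi>"
  have S: "?S \<in> carrier_mat n n" by (simp add: stiffness_matrix_def)
  obtain C where SC: "?S * C = 1\<^sub>m n" and "C * ?S = 1\<^sub>m (dim_row C)"
    using stiffness_matrix_invertible[OF B \<phi> \<psi> inj] S
    unfolding invertible_mat_def inverts_mat_def by auto
  \<comment> \<open>\<open>invertible_mat\<close> prescribes no shape for the inverse; it is read
    off from the two products.\<close>
  then have C: "C \<in> carrier_mat n n"
    using S by (metis carrier_matD(2) carrier_matI index_mult_mat(3) index_one_mat(3))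
  define f where "f = vec n (\<lambda>i. F (\<psi> i))"
  define c where "c = C *\<^sub>v f"
  have c: "c \<in> carrier_vec n" and Sc: "?S *\<^sub>v c = f"
    using S C SC by (auto simp: c_def f_def simp flip: assoc_mult_mat_vec)
  define u where "u = (\<Sum>j<n. vec_index c j *\<^sub>R \<phi> j)"
  have uU: "u \<in> U" unfolding u_def by (rule is_basisD(4)[OF \<phi>])
  have on_basis: "B u (\<psi> i) = F (\<psi> i)" if "i < n" for i
    using stiffness_matrix_mult_vec[OF B \<phi> \<psi> c that] Sc that by (simp add: u_def f_def)
  have sol: "B u v = F v" if "v \<in> W" for v
    by (rule additive_on_eq_span[OF is_basisD(1)[OF \<psi>], of "B u" F])
       (auto simp: bilinear_onD(3,4)[OF B uU] F on_basis that)
  show ?thesis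
  proof (rule ex1I[of _ u])
    show "u \<in> U \<and> (\<forall>v\<in>W. B u v = F v)" using uU sol by blast
  next
    fix u' assume u': "u' \<in> U \<and> (\<forall>v\<in>W. B u' v = F v)"
    have sU: "subspace U" using U(2) subspace_span by blast
    \<comment> \<open>The difference takes this form because \<open>bilinear_on\<close> speaks of
      sums and scalar multiples.\<close>
    have "u' + (-1) *\<^sub>R u = 0"
    proof (rule inj)
      show "u' + (-1) *\<^sub>R u \<in> U" using u' uU sU by (auto intro: subspace_diff)
      show "B (u' + (-1) *\<^sub>R u) v = 0" if "v \<in> W" for v
        using bilinear_onD(1)[OF B _ _ that, of u' "(-1) *\<^sub>R u"] bilinear_onD(2)[OF B uU that, of "-1"]
          u' uU sU sol that by (auto simp: subspace_neg)
    qed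
    then show "u' = u" by simp
  qed
qed

section \<open>The inf-sup condition and quasi-optimality\<close>

text \<open>In the extended reals the condition holds for \<open>U = {0}\<close>, where the infimum
  is over the empty set, and fails if \<open>W = {0}\<close> while \<open>U\<close> has a nonzero
  element.\<close>

definition inf_sup_on :: "'a::zero set \<Rightarrow> ('a \<Rightarrow> real) \<Rightarrow> 'b::zero set \<Rightarrow> ('b \<Rightarrow> real) \<Rightarrow> ('a \<Rightarrow> 'b \<Rightarrow> real) \<Rightarrow> real \<Rightarrow> bool" where
  "inf_sup_on U NU W NW B \<gamma> \<longleftrightarrow>
     (INF w\<in>U - {0}. SUP v\<in>W - {0}. ereal (B w v / (NU w * NW v))) \<ge> ereal \<gamma>"

text \<open>The supremum need not be attained, hence the gap \<open>c < \<gamma>\<close>. Division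
  by 0 gives 0, so a quotient above \<open>c\<close>, with \<open>0 \<le> c\<close>, forces both
  norms to be nonzero.\<close>

lemma inf_sup_onD:
  assumes infsup: "inf_sup_on U NU W NW B \<gamma>" and c: "0 \<le> c" "c < \<gamma>" and w: "w \<in> U" "w \<noteq> 0"
    and nn: "0 \<le> NU w" "\<And>v. v \<in> W \<Longrightarrow> 0 \<le> NW v"
  obtains v where "v \<in> W" "v \<noteq> 0" "0 < NU w" "0 < NW v" "c * NU w * NW v < B w v"
proof -
  have "ereal c < (SUP v\<in>W - {0}. ereal (B w v / (NU w * NW v)))"
    using infsup w c unfolding inf_sup_on_def le_INF_iff
    by (metis (no_types, lifting) Diff_iff empty_iff insertE ereal_less_eq(3) less_ereal.simps(1) order_less_le_trans)
  then obtain v where v: "v \<in> W" "v \<noteq> 0" "c < B w v / (NU w * NW v)"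
    unfolding less_SUP_iff by auto
  then have "NU w * NW v \<noteq> 0" using c by auto
  then have pos: "0 < NU w" "0 < NW v"
    using nn(1) nn(2)[OF v(1)] by (auto simp: less_le)
  with v show ?thesis
    using that by (auto simp: pos_less_divide_eq mult.assoc)
qed

text \<open>For each nonnegative \<open>c\<close> below \<open>\<gamma>\<close> some
  \<open>v\<close> satisfies \<open>c * NU w * NW v < B w v \<le> M * NW v\<close>, and
  \<open>c\<close> may approach \<open>\<gamma>\<close>. The case \<open>c = 0\<close> supplies
  \<open>0 < NU w\<close>.\<close>

lemma inf_sup_on_le:
  assumes infsup: "inf_sup_on U NU W NW B \<gamma>" and \<gamma>: "0 < \<gamma>" and w: "w \<in> U" "w \<noteq> 0"
    and nn: "0 \<le> NU w" "\<And>v. v \<in> W \<Longrightarrow> 0 \<le> NW v"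
    and le: "\<And>v. v \<in> W \<Longrightarrow> B w v \<le> M * NW v"
  shows "\<gamma> * NU w \<le> M"
proof -
  have *: "0 < NU w \<and> c * NU w < M" if "0 \<le> c" "c < \<gamma>" for c
    using inf_sup_onD[OF infsup that w nn] le
    by (metis mult_less_cancel_right_pos order_less_le_trans)
  have "0 < NU w" using *[of 0] \<gamma> by simp
  moreover have "\<gamma> \<le> M / NU w"
  proof (rule dense_le_bounded[of 0])
    show "c \<le> M / NU w" if "0 < c" "c < \<gamma>" for c
      using *[of c] that by (simp add: pos_le_divide_eq)
  qed (rule \<gamma>)
  ultimately show ?thesis by (simp add: pos_le_divide_eq)
qed

text \<open>The argument stays in the span of \<open>p\<close> and \<open>q\<close>. It is the
  planar form of the fact that a projection on a Hilbert space, neither 0 nor the identity, has the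
  same norm as its complement.\<close>

lemma galerkin_quasi_optimal:
  assumes X: "subspace X" and N: "nonneg_quadratic_on X (\<lambda>u. (N u)\<^sup>2)" "\<And>u. u \<in> X \<Longrightarrow> 0 \<le> N u"
    and B: "bilinear_on X Y B" and U: "subspace U" "U \<subseteq> X" and W: "W \<subseteq> Y"
    and bound: "\<And>w v. w \<in> X \<Longrightarrow> v \<in> Y \<Longrightarrow> \<bar>B w v\<bar> \<le> C * N w * NY v"
    and NY: "\<And>v. v \<in> Y \<Longrightarrow> 0 \<le> NY v"
    and infsup: "inf_sup_on U N W NY B \<gamma>" and \<gamma>: "0 < \<gamma>" "\<gamma> \<le> C"
    and u: "u \<in> X" and ul: "ul \<in> U" "\<And>v. v \<in> W \<Longrightarrow> B ul v = B u v" and v: "v \<in> U"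
  shows "\<gamma> * N (u - ul) \<le> C * N (u - v)"
proof -
  define p q where "p = ul - v" and "q = u - ul"
  have pU: "p \<in> U" unfolding p_def by (rule subspace_diff[OF U(1) ul(1) v])
  have pX: "p \<in> X" and qX: "q \<in> X"
    using pU U ul(1) u X by (auto simp: q_def intro: subspace_diff)
  have orth: "B q v = 0" if "v \<in> W" for v
  proof -
    have vY: "v \<in> Y" and ulX: "ul \<in> X" using that W U ul(1) by auto
    then have "B (u + (-1) *\<^sub>R ul) v = 0"
      using bilinear_onD(1)[OF B u _ vY, of "(-1) *\<^sub>R ul"] bilinear_onD(2)[OF B ulX vY, of "-1"]
        ul(2)[OF that] X by (auto simp: subspace_neg)
    then show ?thesis by (simp add: q_def)
  qed
  have pq: "u - v = p + q" by (simp add: p_def q_def)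
  \<comment> \<open>Multiples of \<open>q\<close> are invisible to test functions in
    \<open>W\<close>, by \<open>orth\<close>, so \<open>t\<close> is free.\<close>
  have key: "\<gamma> * N (s *\<^sub>R p) \<le> C * N (s *\<^sub>R p + t *\<^sub>R q)" if "s *\<^sub>R p \<noteq> 0" for s t
  proof (rule inf_sup_on_le[OF infsup \<gamma>(1) _ that])
    show spU: "s *\<^sub>R p \<in> U" by (rule subspace_scale[OF U(1) pU])
    then show "0 \<le> N (s *\<^sub>R p)" using N(2) U by auto
    show "0 \<le> NY v" if "v \<in> W" for v using NY W that by auto
    show "B (s *\<^sub>R p) v \<le> C * N (s *\<^sub>R p + t *\<^sub>R q) * NY v" if "v \<in> W" for v
    proof -
      have "B (s *\<^sub>R p) v = B (s *\<^sub>R p + t *\<^sub>R q) v"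
        using bilinear_onD(1,2)[OF B] orth[OF that] that W pX qX X by (auto simp: subspace_scale)
      then show ?thesis
        using bound[of "s *\<^sub>R p + t *\<^sub>R q" v] pX qX X W that by (auto simp: subspace_scale subspace_add)
    qed
  qed
  show ?thesis
  \<comment> \<open>If \<open>p = 0\<close>, then \<open>u - v = q\<close> and the claim reduces to
    \<open>\<gamma> \<le> C\<close>. If \<open>N q = 0\<close>, its left side vanishes.\<close>
  proof (cases "p = 0 \<or> N q = 0")
    case True
    then show ?thesis
    proof
      assume "p = 0"
      then show ?thesis
        using mult_right_mono[OF \<gamma>(2) N(2)[OF qX]] pq by (simp flip: q_def)
    next
      assume "N q = 0"
      then show ?thesis
        using \<gamma> N(2)[of "p + q"] pX qX X by (simp add: pq subspace_add flip: q_def)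
    qed
  next
    case False
    then have p0: "p \<noteq> 0" and Nq: "0 < N q" using N(2)[OF qX] by auto
    have Np: "0 < N p"
      using inf_sup_onD[OF infsup order_refl \<gamma>(1) pU p0 N(2)[OF pX]] NY W by auto
    \<comment> \<open>With this \<open>s\<close> the factors \<open>s\<close> and \<open>1 / s\<close> exchange the norms of \<open>p\<close> and \<open>q\<close>.\<close>
    define s where "s = N q / N p"
    have s: "0 < s" using Np Nq by (simp add: s_def)
    have sp: "(N (s *\<^sub>R p))\<^sup>2 = (N q)\<^sup>2"
      using nonneg_quadratic_onD(2)[OF N(1) pX, of s] Np by (simp add: s_def power_divide)
    \<comment> \<open>The squares of the two norms change places, and the mixed term keeps its
      coefficient because \<open>s * (1 / s) = 1\<close>.\<close>
    have "(N (s *\<^sub>R p + (1 / s) *\<^sub>R q))\<^sup>2 = (N (p + q))\<^sup>2"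
      using nonneg_quadratic_on_combination[OF X N(1) pX qX, of s "1 / s"] Np Nq
      by (simp add: s_def power_divide)
    then have "N (s *\<^sub>R p + (1 / s) *\<^sub>R q) = N (p + q)"
      using N(2) pX qX X by (simp add: subspace_add subspace_scale)
    moreover have "N (s *\<^sub>R p) = N q"
      using sp N(2) pX qX X by (simp add: subspace_scale)
    ultimately show ?thesis
      using key[of s "1 / s"] s p0 by (simp add: pq flip: q_def)
  qed
qed

section \<open>Square integrable functions and weak derivatives\<close>

lemma square_integrable_rep: "square_integrable (rep_L2 u)"
  using Quotient_rep_reflp[OF Quotient_L2, of u] by (simp add: L2_eq_def)

lemma measurable_rep_L2 [measurable]: "rep_L2 u \<in> borel_measurable half_line"
  using square_integrable_rep[of u] by (simp add: square_integrable_def)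

lemma L2_eqI:
  assumes "AE t in half_line. rep_L2 u t = rep_L2 v t"
  shows "u = v"
  using assms Quotient_rel_rep[OF Quotient_L2, of u v]
  by (simp add: L2_eq_def square_integrable_rep)

lemma represents_unique:
  assumes "represents f u" "represents f v"
  shows "u = v"
  using assms unfolding represents_def by (intro L2_eqI) auto

lemma represents_rep: "represents (rep_L2 u) u"
  by (simp add: represents_def)

lemma represents_abs:
  assumes "square_integrable f"
  shows "represents f (abs_L2 f)"
  using Quotient_rep_abs[OF Quotient_L2, of f] assms by (simp add: represents_def L2_eq_def)

lemma rep_L2_add: "AE t in half_line. rep_L2 (u + v) t = rep_L2 u t + rep_L2 v t"
  using represents_abs[OF square_integrable_add[OF square_integrable_rep[of u] square_integrable_rep[of v]]]
  by (simp add: plus_L2_def represents_def)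

lemma rep_L2_scaleR: "AE t in half_line. rep_L2 (c *\<^sub>R u) t = c *\<^sub>R rep_L2 u t"
  using represents_abs[OF square_integrable_scaleR[OF square_integrable_rep[of u], of c]]
  by (simp add: scaleR_L2_def represents_def)

lemma represents_add:
  assumes "represents f u" "represents g v"
  shows "represents (\<lambda>t. f t + g t) (u + v)"
  using assms rep_L2_add[of u v] unfolding represents_def by eventually_elim simp

lemma represents_scaleR:
  assumes "represents f u"
  shows "represents (\<lambda>t. c *\<^sub>R f t) (c *\<^sub>R u)"
  using assms rep_L2_scaleR[of c u] unfolding represents_def by eventually_elim simp

lemma inner_L2_rep: "inner u v = (\<integral>t. inner (rep_L2 u t) (rep_L2 v t) \<partial>half_line)"
  by (simp add: inner_L2_def)

lemma mult_le_sum_squares: "a * b \<le> a\<^sup>2 + b\<^sup>2" for a b :: real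
proof -
  have "0 \<le> (a + b)\<^sup>2" "0 \<le> (a - b)\<^sup>2" by simp_all
  then show ?thesis unfolding power2_sum power2_diff by linarith
qed

lemma square_integrable_scaleR_integrable:
  fixes f :: "real \<Rightarrow> 'h::{real_inner,banach,second_countable_topology}"
  assumes "square_integrable g" "square_integrable f"
  shows "integrable half_line (\<lambda>t. g t *\<^sub>R f t)"
proof -
  have [measurable]: "f \<in> borel_measurable half_line" "g \<in> borel_measurable half_line"
    using assms by (auto simp: square_integrable_def)
  have "integrable half_line (\<lambda>t. (norm (g t))\<^sup>2 + (norm (f t))\<^sup>2)"
    using assms by (auto simp: square_integrable_def)
  then show ?thesis
    using mult_le_sum_squares[of "norm (g t)" "norm (f t)" for t]
    by (rule_tac Bochner_Integration.integrable_bound) (auto intro!: AE_I2)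
qed

lemma square_integrable_indicator:
  "square_integrable (indicator {a<..<b} :: real \<Rightarrow> real)"
proof -
  have "integrable lborel (\<lambda>t. indicator ({0<..} \<inter> {a<..<b}) t :: real)"
    by (intro integrable_real_indicator emeasure_bounded_finite bounded_Int) auto
  then have "integrable half_line (indicator {a<..<b} :: real \<Rightarrow> real)"
    unfolding half_line_def by (simp add: integrable_restrict_space indicator_inter_arith)
  moreover have "(norm (indicator {a<..<b} t :: real))\<^sup>2 = indicator {a<..<b} t" for t :: real
    by (simp add: indicator_def)
  ultimately show ?thesis
    unfolding square_integrable_def
    by (simp add: half_line_def measurable_restrict_space1)
qed

lemma square_integrable_continuous_compact:
  fixes f :: "real \<Rightarrow> real"
  assumes f: "continuous_on UNIV f" and K: "compact K" and z: "\<And>t. t \<notin> K \<Longrightarrow> f t = 0"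
  shows "square_integrable f"
proof -
  have [measurable]: "f \<in> borel_measurable borel"
    by (rule borel_measurable_continuous_onI[OF f])
  have "integrable lborel (\<lambda>x. indicator K x *\<^sub>R (f x)\<^sup>2)"
    using f by (intro borel_integrable_compact[OF K] continuous_intros) (auto intro: continuous_on_subset)
  then have "integrable lborel (\<lambda>x. indicator {0<..} x *\<^sub>R (indicator K x *\<^sub>R (f x)\<^sup>2))"
    by (rule integrable_mult_indicator[rotated]) simp
  moreover have "indicator K x *\<^sub>R (f x)\<^sup>2 = (f x)\<^sup>2" for x
    using z by (cases "x \<in> K") auto
  ultimately have "integrable lborel (\<lambda>x. indicator {0<..} x *\<^sub>R (f x)\<^sup>2)"
    by (simp only:)
  then have "integrable half_line (\<lambda>x. (f x)\<^sup>2)"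
    unfolding half_line_def by (simp add: integrable_restrict_space)
  then show ?thesis
    unfolding square_integrable_def by (simp add: half_line_def measurable_restrict_space1)
qed

text \<open>Hence the integrands in \<open>has_weak_derivative\<close> are products of square
  integrable functions, and the integrals may be split over sums.\<close>

lemma C1_compact_support_square_integrable:
  fixes \<phi> :: "real \<Rightarrow> real"
  assumes "\<phi> \<in> C1_compact_support S"
  shows "square_integrable \<phi>" "square_integrable (deriv \<phi>)"
proof -
  obtain K D where K: "compact K" "\<And>t. t \<notin> K \<Longrightarrow> \<phi> t = 0"
    and D: "\<And>t. (\<phi> has_vector_derivative D t) (at t)" "continuous_on UNIV D"
    using assms unfolding C1_compact_support_def C1_differentiable_on_def by auto
  have "continuous_on UNIV \<phi>"
    using D(1) by (auto intro!: continuous_at_imp_continuous_on has_vector_derivative_continuous)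
  then show "square_integrable \<phi>"
    by (rule square_integrable_continuous_compact[OF _ K])
  have DERIV: "(\<phi> has_field_derivative D t) (at t)" for t
    using D(1) by (simp add: has_real_derivative_iff_has_vector_derivative)
  then have deriv: "deriv \<phi> = D"
    by (auto intro: DERIV_imp_deriv)
  \<comment> \<open>The complement of \<open>K\<close> is open, so \<open>\<phi>\<close> is 0 in a
    neighbourhood of \<open>t\<close>.\<close>
  have "D t = 0" if t: "t \<notin> K" for t
  proof -
    have "((\<lambda>_. 0) has_field_derivative D t) (at t)"
      by (rule DERIV_cong_ev[THEN iffD1, OF refl _ refl DERIV])
         (use eventually_nhds_in_open[of "- K" t] K t in
           \<open>auto simp: open_Compl compact_imp_closed elim!: eventually_mono\<close>)
    then show ?thesis using DERIV_unique[OF _ DERIV_const] by blast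
  qed
  then show "square_integrable (deriv \<phi>)"
    unfolding deriv by (rule square_integrable_continuous_compact[OF D(2) K(1)])
qed

lemma has_weak_derivative_add:
  assumes "has_weak_derivative u f" "has_weak_derivative v g"
  shows "has_weak_derivative (u + v) (f + g)"
proof -
  have *: "(\<integral>t. \<phi> t *\<^sub>R rep_L2 (u + v) t \<partial>half_line) =
      (\<integral>t. \<phi> t *\<^sub>R rep_L2 u t \<partial>half_line) + (\<integral>t. \<phi> t *\<^sub>R rep_L2 v t \<partial>half_line)"
    if "square_integrable \<phi>" for \<phi> and u v :: "'a L2"
  proof -
    have [measurable]: "\<phi> \<in> borel_measurable half_line"
      using that by (simp add: square_integrable_def)
    have "(\<integral>t. \<phi> t *\<^sub>R rep_L2 (u + v) t \<partial>half_line) =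
        (\<integral>t. \<phi> t *\<^sub>R rep_L2 u t + \<phi> t *\<^sub>R rep_L2 v t \<partial>half_line)"
      using rep_L2_add[of u v] by (intro integral_cong_AE) (auto simp: scaleR_add_right)
    also have "\<dots> = (\<integral>t. \<phi> t *\<^sub>R rep_L2 u t \<partial>half_line) + (\<integral>t. \<phi> t *\<^sub>R rep_L2 v t \<partial>half_line)"
      by (intro Bochner_Integration.integral_add square_integrable_scaleR_integrable that square_integrable_rep)
    finally show ?thesis .
  qed
  show ?thesis
    using assms unfolding has_weak_derivative_def
    by (simp add: * C1_compact_support_square_integrable)
qed

lemma has_weak_derivative_scaleR:
  assumes "has_weak_derivative u f"
  shows "has_weak_derivative (c *\<^sub>R u) (c *\<^sub>R f)"
proof -
  have *: "(\<integral>t. \<phi> t *\<^sub>R rep_L2 (c *\<^sub>R u) t \<partial>half_line) = c *\<^sub>R (\<integral>t. \<phi> t *\<^sub>R rep_L2 u t \<partial>half_line)"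
    if "square_integrable \<phi>" for \<phi> and u :: "'a L2"
  proof -
    have [measurable]: "\<phi> \<in> borel_measurable half_line"
      using that by (simp add: square_integrable_def)
    have "(\<integral>t. \<phi> t *\<^sub>R rep_L2 (c *\<^sub>R u) t \<partial>half_line) = (\<integral>t. c *\<^sub>R (\<phi> t *\<^sub>R rep_L2 u t) \<partial>half_line)"
      using rep_L2_scaleR[of c u] by (intro integral_cong_AE) (auto simp: mult.commute)
    also have "\<dots> = c *\<^sub>R (\<integral>t. \<phi> t *\<^sub>R rep_L2 u t \<partial>half_line)"
      by (intro integral_scaleR_right square_integrable_scaleR_integrable that square_integrable_rep)
    finally show ?thesis .
  qed
  show ?thesis
    using assms unfolding has_weak_derivative_def
    by (simp add: * C1_compact_support_square_integrable)
qed

section \<open>The fundamental lemma of the calculus of variations and uniqueness of weak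
  derivatives\<close>

text \<open>The integral of \<open>f\<close> cut off to \<open>(a, b)\<close> vanishes over all sets
  \<open>{..<x}\<close>. These are stable under intersection and generate the Borel sets, so it
  vanishes over every Borel set, which makes the cut-off function 0 almost everywhere.\<close>

lemma AE_eq_0_if_interval_integrals_eq_0:
  fixes f :: "real \<Rightarrow> 'h::{real_inner,banach,second_countable_topology}"
  assumes int: "\<And>a b. 0 < a \<Longrightarrow> a < b \<Longrightarrow> set_integrable lborel {a<..<b} f"
    and zero: "\<And>a b. 0 < a \<Longrightarrow> a < b \<Longrightarrow> (LINT x:{a<..<b}|lborel. f x) = 0"
  shows "AE x in lborel. 0 < x \<longrightarrow> f x = 0"
proof -
  have *: "AE x in lborel. a < x \<and> x < b \<longrightarrow> f x = 0" if ab: "0 < a" "a < b" for a b :: real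
  proof -
    define g where "g x = indicator {a<..<b} x *\<^sub>R f x" for x
    have g: "integrable lborel g"
      using int[OF ab] by (simp add: set_integrable_def g_def[abs_def])
    have set_g: "set_integrable lborel A g" if "A \<in> sets borel" for A
      using integrable_mult_indicator[OF _ g] that by (simp add: set_integrable_def)
    have g0: "(LINT x|lborel. g x) = 0"
      using zero[OF ab] by (simp add: set_lebesgue_integral_def g_def)
    have "(LINT x:A|lborel. g x) = 0" if "A \<in> sets borel" for A
    proof -
      have eq: "sets borel = sigma_sets UNIV (range (lessThan :: real \<Rightarrow> _))"
        by (subst borel_Iio) simp
      have "{..<x} \<inter> {..<y} = {..<min x y}" for x y :: real by auto
      then have "Int_stable (range (lessThan :: real \<Rightarrow> _))"
        by (auto simp: Int_stable_def)
      moreover have "range (lessThan :: real \<Rightarrow> _) \<subseteq> Pow UNIV" by simp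
      moreover have "A \<in> sigma_sets UNIV (range lessThan)" using that eq by simp
      ultimately show ?thesis
      proof (induction rule: sigma_sets_induct_disjoint)
        case (basic A)
        then obtain x where A: "A = {..<x}" by auto
        have "(LINT t:A|lborel. g t) = (LINT t:{a<..<min b x}|lborel. f t)"
          unfolding set_lebesgue_integral_def g_def A
          by (intro Bochner_Integration.integral_cong) (auto simp: indicator_def)
        also have "\<dots> = 0"
          using zero[of a "min b x"] ab by (cases "a < min b x") (auto simp: set_lebesgue_integral_def)
        finally show ?case .
      next
        case empty
        show ?case by (simp add: set_lebesgue_integral_def)
      next
        case (compl A)
        then have A: "A \<in> sets borel" using eq by simp
        have "(LINT t:A \<union> (UNIV - A)|lborel. g t) = (LINT t:A|lborel. g t) + (LINT t:UNIV - A|lborel. g t)"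
          using A by (intro set_integral_Un set_g) auto
        then show ?case
          using compl g0 by (simp add: set_lebesgue_integral_def)
      next
        case (union A)
        then have A: "A i \<in> sets lborel" for i using eq by auto
        have "(LINT t:\<Union>i. A i|lborel. g t) = (\<Sum>i. LINT t:A i|lborel. g t)"
          by (rule lebesgue_integral_countable_add)
             (use A union in \<open>auto simp: disjoint_family_on_def intro!: set_g\<close>)
        then show ?case using union by simp
      qed
    qed
    then have "AE x in lborel. g x = 0"
      by (rule sigma_finite_measure.density_zero[OF sigma_finite_lborel g]) auto
    then show ?thesis
      by eventually_elim (auto simp: g_def)
  qed
  \<comment> \<open>Countably many intervals exhaust the positive half-line. The added 1 keeps the
    one for \<open>n = 0\<close> nonempty.\<close>
  have "AE x in lborel. \<forall>n. 1 / real (Suc n) < x \<and> x < real (Suc n) + 1 \<longrightarrow> f x = 0"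
    unfolding AE_all_countable
    by (intro allI *) (auto intro: order_le_less_trans[of _ 1])
  then show ?thesis
  proof eventually_elim
    case (elim x)
    show ?case
    proof
      assume x: "0 < x"
      obtain m where m: "x < real m" using reals_Archimedean2 by blast
      obtain n where n: "1 / real (Suc n) < x"
        using reals_Archimedean[OF x] by (auto simp: inverse_eq_divide)
      have "1 / real (Suc (max m n)) \<le> 1 / real (Suc n)"
        by (intro divide_left_mono) auto
      with m n elim[rule_format, of "max m n"] show "f x = 0" by auto
    qed
  qed
qed

text \<open>The functions \<open>1 - 1 / (1 + n * p)\<close> with \<open>p t = (max 0 ((t - a) * (b - t)))\<^sup>2\<close> are continuously
  differentiable, supported in \<open>[a, b]\<close>, and increase to the indicator function of \<open>(a, b)\<close>.\<close>

lemma C1_approximates_indicator: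
  fixes a b :: real
  assumes ab: "0 < a" "a < b"
  obtains \<phi> :: "nat \<Rightarrow> real \<Rightarrow> real" where "\<And>n. \<phi> n \<in> C1_compact_support {0<..}"
    and "\<And>n t. \<bar>\<phi> n t\<bar> \<le> indicator {a<..<b} t"
    and "\<And>t. (\<lambda>n. \<phi> n t) \<longlonglongrightarrow> indicator {a<..<b} t"
proof
  define m where "m x = max 0 x" for x :: real
  define p where "p t = (m ((t - a) * (b - t)))\<^sup>2" for t
  define \<phi> where "\<phi> n t = 1 - 1 / (1 + real n * p t)" for n t
  have m: "((\<lambda>x. (m x)\<^sup>2) has_real_derivative 2 * m x) (at x)" for x
  proof (cases x "0::real" rule: linorder_cases)
    case less
    have "((\<lambda>_. 0) has_real_derivative 2 * m x) (at x)"
      using less by (simp add: m_def)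
    moreover have "eventually (\<lambda>y. (m y)\<^sup>2 = 0) (nhds x)"
      using eventually_nhds_in_open[of "{..<0}" x] less by (auto simp: m_def elim!: eventually_mono)
    ultimately show ?thesis
      by (subst DERIV_cong_ev[OF refl _ refl, of _ "\<lambda>_. 0"]) auto
  next
    case greater
    have "((\<lambda>y. y\<^sup>2) has_real_derivative 2 * m x) (at x)"
      using greater by (auto simp: m_def intro!: derivative_eq_intros)
    moreover have "eventually (\<lambda>y. (m y)\<^sup>2 = y\<^sup>2) (nhds x)"
      using eventually_nhds_in_open[of "{0<..}" x] greater by (auto simp: m_def elim!: eventually_mono)
    ultimately show ?thesis
      by (subst DERIV_cong_ev[OF refl _ refl, of _ "\<lambda>y. y\<^sup>2"]) auto
  next
    \<comment> \<open>At 0 the difference quotient of the squared positive part has size at most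
      \<open>\<bar>h\<bar>\<close>; the square is what makes \<open>p\<close> differentiable at
      \<open>a\<close> and \<open>b\<close>.\<close>
    case equal
    have "((\<lambda>h. ((m (x + h))\<^sup>2 - (m x)\<^sup>2) / h) \<longlongrightarrow> 0) (at 0)"
    proof (rule Lim_null_comparison)
      show "eventually (\<lambda>h. norm (((m (x + h))\<^sup>2 - (m x)\<^sup>2) / h) \<le> \<bar>h\<bar>) (at 0)"
        using equal by (intro always_eventually) (auto simp: m_def max_def power2_eq_square)
      show "((\<lambda>h::real. \<bar>h\<bar>) \<longlongrightarrow> 0) (at 0)"
        by (auto intro!: tendsto_eq_intros)
    qed
    then show ?thesis using equal by (simp add: DERIV_def m_def)
  qed
  have mc: "continuous_on UNIV m"
    unfolding m_def by (intro continuous_intros)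
  have p: "(p has_real_derivative 2 * m ((t - a) * (b - t)) * (b - t - (t - a))) (at t)" for t
    unfolding p_def[abs_def]
    by (rule DERIV_chain2[where f = "\<lambda>x. (m x)\<^sup>2" and g = "\<lambda>t. (t - a) * (b - t)", OF m])
       (auto intro!: derivative_eq_intros simp: algebra_simps)
  have p0: "0 \<le> p t" for t by (simp add: p_def)
  have pos: "0 < 1 + real n * p t" for n t
    using p0[of t] by (simp add: add_pos_nonneg)
  have pc: "continuous_on UNIV p"
    unfolding p_def m_def by (intro continuous_intros)
  have out: "p t = 0" if "t \<notin> {a<..<b}" for t
    using that ab by (auto simp: p_def m_def max_def not_less mult_nonneg_nonpos mult_nonpos_nonneg zero_le_mult_iff zero_less_mult_iff)
  have inside: "0 < p t" if "t \<in> {a<..<b}" for t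
    using that by (auto simp: p_def m_def)
  show "\<phi> n \<in> C1_compact_support {0<..}" for n
    unfolding C1_compact_support_def C1_differentiable_on_def mem_Collect_eq
  proof (intro conjI exI ballI)
    let ?D = "\<lambda>t. real n * (2 * m ((t - a) * (b - t)) * (b - t - (t - a))) / (1 + real n * p t)\<^sup>2"
    show "(\<phi> n has_vector_derivative ?D t) (at t)" for t
      unfolding has_real_derivative_iff_has_vector_derivative[symmetric] \<phi>_def[abs_def]
      using pos[of n t] by (auto intro!: derivative_eq_intros p simp: power2_eq_square)
    show "continuous_on UNIV ?D"
      using pos by (intro continuous_intros pc continuous_on_compose2[OF mc]) (auto simp: less_imp_neq[symmetric])
    show "compact {a..b}" by simp
    show "{a..b} \<subseteq> {0<..}" using ab by auto
    show "\<forall>t. t \<notin> {a..b} \<longrightarrow> \<phi> n t = 0"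
    proof (intro allI impI)
      fix t assume "t \<notin> {a..b}"
      then have "p t = 0" by (intro out) auto
      then show "\<phi> n t = 0" by (simp add: \<phi>_def)
    qed
  qed
  show "\<bar>\<phi> n t\<bar> \<le> indicator {a<..<b} t" for n t
  proof (cases "t \<in> {a<..<b}")
    case True
    have "0 \<le> \<phi> n t" "\<phi> n t \<le> 1"
      using pos[of n t] p0[of t] by (simp_all add: \<phi>_def)
    then show ?thesis using True by simp
  qed (simp add: \<phi>_def out)
  show "(\<lambda>n. \<phi> n t) \<longlonglongrightarrow> indicator {a<..<b} t" for t
  proof (cases "t \<in> {a<..<b}")
    case True
    have "(\<lambda>n. \<phi> n t) \<longlonglongrightarrow> 1"
      unfolding \<phi>_def using inside[OF True] by real_asymp
    then show ?thesis using True by simp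
  qed (simp add: \<phi>_def out)
qed

text \<open>Test functions that approximate the indicator of an interval transfer the vanishing to
  interval integrals. Dominated convergence applies because the cut-off of \<open>rep_L2 g\<close>
  to a bounded interval is integrable.\<close>

lemma L2_eq_0_if_orthogonal:
  fixes g :: "'h::{real_inner,banach,second_countable_topology} L2"
  assumes "\<And>\<phi>. \<phi> \<in> C1_compact_support {0<..} \<Longrightarrow> (\<integral>t. \<phi> t *\<^sub>R rep_L2 g t \<partial>half_line) = 0"
  shows "g = 0"
proof -
  have ind: "integrable half_line (\<lambda>t. indicator {a<..<b} t *\<^sub>R rep_L2 g t)" for a b :: real
    by (rule square_integrable_scaleR_integrable[OF square_integrable_indicator square_integrable_rep])
  \<comment> \<open>For \<open>0 < a\<close> the interval lies in the half-line, so
    \<open>half_line\<close> and \<open>lborel\<close> give the same integrals over it.\<close>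
  have lb: "indicator {0<..} t * indicator {a<..<b} t = (indicator {a<..<b} t :: real)"
    if "0 < a" for a b t :: real
    using that by (auto simp: indicator_def)
  have "AE x in lborel. 0 < x \<longrightarrow> rep_L2 g x = 0"
  proof (rule AE_eq_0_if_interval_integrals_eq_0)
    fix a b :: real assume ab: "0 < a" "a < b"
    show "set_integrable lborel {a<..<b} (rep_L2 g)"
      using ind[of a b] lb[OF ab(1)]
      by (simp add: half_line_def integrable_restrict_space set_integrable_def)
    obtain \<phi> :: "nat \<Rightarrow> real \<Rightarrow> real" where \<phi>: "\<And>n. \<phi> n \<in> C1_compact_support {0<..}"
      "\<And>n t. \<bar>\<phi> n t\<bar> \<le> indicator {a<..<b} t" "\<And>t. (\<lambda>n. \<phi> n t) \<longlonglongrightarrow> indicator {a<..<b} t"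
      using C1_approximates_indicator[OF ab] by blast
    have [measurable]: "\<phi> n \<in> borel_measurable half_line" for n
      using C1_compact_support_square_integrable(1)[OF \<phi>(1)] by (simp add: square_integrable_def)
    have "(\<lambda>n. \<integral>t. \<phi> n t *\<^sub>R rep_L2 g t \<partial>half_line) \<longlonglongrightarrow> (\<integral>t. indicator {a<..<b} t *\<^sub>R rep_L2 g t \<partial>half_line)"
    proof (rule integral_dominated_convergence)
      show "integrable half_line (\<lambda>t. norm (indicator {a<..<b} t *\<^sub>R rep_L2 g t))"
        by (rule integrable_norm[OF ind])
      show "(\<lambda>t. indicator {a<..<b} t *\<^sub>R rep_L2 g t) \<in> borel_measurable half_line"
        by (rule borel_measurable_integrable[OF ind])
      show "AE t in half_line. (\<lambda>n. \<phi> n t *\<^sub>R rep_L2 g t) \<longlonglongrightarrow> indicator {a<..<b} t *\<^sub>R rep_L2 g t"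
        by (intro AE_I2 tendsto_scaleR \<phi>(3) tendsto_const)
      show "AE t in half_line. norm (\<phi> n t *\<^sub>R rep_L2 g t) \<le> norm (indicator {a<..<b} t *\<^sub>R rep_L2 g t)" for n
        using \<phi>(2)[of n] by (intro AE_I2) (auto intro!: mult_right_mono)
    qed simp
    then have "(\<integral>t. indicator {a<..<b} t *\<^sub>R rep_L2 g t \<partial>half_line) = 0"
      using assms[OF \<phi>(1)] by (simp add: LIMSEQ_const_iff)
    then show "(LINT x:{a<..<b}|lborel. rep_L2 g x) = 0"
      using lb[OF ab(1)] by (simp add: half_line_def integral_restrict_space set_lebesgue_integral_def)
  qed
  then have "AE t in half_line. rep_L2 g t = 0"
    unfolding half_line_def by (subst AE_restrict_space_iff) auto
  moreover have "represents (\<lambda>_. 0) (0 :: 'h L2)"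
    using represents_abs[OF square_integrable_zero] by (simp add: zero_L2_def)
  ultimately show ?thesis
    by (intro represents_unique[of "\<lambda>_. 0"]) (auto simp: represents_def)
qed

text \<open>\<open>rep_L2 0\<close> is a selected representative, known to vanish only almost
  everywhere.\<close>

lemma integral_scaleR_rep_L2_zero:
  assumes "square_integrable \<phi>"
  shows "(\<integral>t. \<phi> t *\<^sub>R rep_L2 (0 :: 'h::{real_inner,banach,second_countable_topology} L2) t \<partial>half_line) = 0"
proof -
  have "(\<integral>t. \<phi> t *\<^sub>R rep_L2 (0 :: 'h L2) t \<partial>half_line) = (\<integral>t. 0 \<partial>half_line)"
    using rep_L2_scaleR[of 0 "0 :: 'h L2"] assms
    by (intro integral_cong_AE) (auto simp: square_integrable_def)
  then show ?thesis by simp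
qed

lemma has_weak_derivative_zero: "has_weak_derivative 0 0"
  unfolding has_weak_derivative_def
  by (simp add: integral_scaleR_rep_L2_zero C1_compact_support_square_integrable)

text \<open>The difference of two weak derivatives of \<open>u\<close> is one of 0, hence orthogonal
  to all test functions. This gives the description in \<open>H1_norm\<close> its meaning.\<close>

lemma has_weak_derivative_unique:
  assumes "has_weak_derivative u f" "has_weak_derivative u g"
  shows "f = g"
proof -
  have "has_weak_derivative (u + (-1) *\<^sub>R u) (f + (-1) *\<^sub>R g)"
    using assms by (intro has_weak_derivative_add has_weak_derivative_scaleR)
  then have "f - g = 0"
    by (intro L2_eq_0_if_orthogonal)
       (simp add: has_weak_derivative_def integral_scaleR_rep_L2_zero C1_compact_support_square_integrable)
  then show ?thesis by simp
qed

section \<open>Interpolation norms and the space-time form\<close>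

lemma nonneg_quadratic_on_K_functional:
  fixes D :: "'a::real_inner set"
  assumes "subspace D" and "nonneg_quadratic_on D (\<lambda>u. (N u)\<^sup>2)"
  shows "nonneg_quadratic_on UNIV (K_functional_sq D N s)"
proof -
  have "nonneg_quadratic_on UNIV (\<lambda>u::'a. (norm u)\<^sup>2)"
    by (rule nonneg_quadratic_on_norm_sq[where f = "\<lambda>u. u"]) auto
  moreover have "nonneg_quadratic_on D (\<lambda>d. s\<^sup>2 * (N d)\<^sup>2)"
    by (rule nonneg_quadratic_on_cmult[OF assms(2)]) simp
  ultimately show ?thesis
    unfolding K_functional_sq_def[abs_def]
    by (intro nonneg_quadratic_on_INF assms(1) subspace_UNIV)
qed

lemma K_functional_sq_mono:
  assumes D: "D \<noteq> {}" and "0 \<le> s" "s \<le> t"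
  shows "K_functional_sq D N s u \<le> K_functional_sq D N t u"
  unfolding K_functional_sq_def
proof (rule cINF_mono[OF D])
  show "bdd_below ((\<lambda>u1. (norm (u - u1))\<^sup>2 + s\<^sup>2 * (N u1)\<^sup>2) ` D)"
    by (rule bdd_belowI[of _ 0]) auto
  show "\<exists>n\<in>D. (norm (u - n))\<^sup>2 + s\<^sup>2 * (N n)\<^sup>2 \<le> (norm (u - m))\<^sup>2 + t\<^sup>2 * (N m)\<^sup>2"
    if "m \<in> D" for m
    using that assms by (intro bexI[of _ m] add_left_mono mult_right_mono power_mono) auto
qed

text \<open>An infimum over a possibly uncountable \<open>D\<close> is not measurable for general
  reasons; monotonicity in \<open>s\<close> is used instead. As that is shown for nonnegative
  \<open>s\<close>, the argument is first replaced by \<open>max 0 s\<close>.\<close>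

lemma K_functional_sq_measurable:
  assumes "D \<noteq> {}"
  shows "(\<lambda>s. K_functional_sq D N s u / s\<^sup>2) \<in> borel_measurable half_line"
proof -
  have "mono (\<lambda>s. K_functional_sq D N (max 0 s) u)"
    by (intro monoI K_functional_sq_mono assms) auto
  then have [measurable]: "(\<lambda>s. K_functional_sq D N (max 0 s) u) \<in> borel_measurable borel"
    by (rule borel_measurable_mono)
  have "(\<lambda>s. K_functional_sq D N (max 0 s) u / s\<^sup>2) \<in> borel_measurable half_line"
    unfolding half_line_def by (rule measurable_restrict_space1) measurable
  then show ?thesis
    by (rule measurable_cong[THEN iffD1, rotated]) (auto simp: half_line_def space_restrict_space)
qed

text \<open>For fixed \<open>s\<close> the integrand is quadratic in \<open>u\<close>. Dropping the
  term of \<open>u - v\<close> from its parallelogram law dominates the integrand of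
  \<open>u + v\<close>, which gives closure under sums; integrating the law gives it for the
  norm.\<close>

lemma interp_half_quadratic:
  fixes D :: "'a::real_inner set"
  assumes D: "subspace D" and N: "nonneg_quadratic_on D (\<lambda>u. (N u)\<^sup>2)"
  shows "subspace (interp_half D N)"
    and "nonneg_quadratic_on (interp_half D N) (\<lambda>u. (interp_half_norm D N u)\<^sup>2)"
proof -
  let ?k = "\<lambda>u s. K_functional_sq D N s u / s\<^sup>2"
  note K = nonneg_quadratic_onD[OF nonneg_quadratic_on_K_functional[OF D N]]
  have meas: "?k u \<in> borel_measurable half_line" for u
    using subspace_0[OF D] by (intro K_functional_sq_measurable) auto
  have nn: "0 \<le> ?k u s" for u s using K(1) by simp
  have scale: "?k (c *\<^sub>R u) s = c\<^sup>2 * ?k u s" for c u s using K(2) by simp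
  have par: "?k (u + v) s + ?k (u - v) s = 2 * ?k u s + 2 * ?k v s" for u v s
    using K(3)[of u v s] by (simp flip: add_divide_distrib)
  show sub: "subspace (interp_half D N)"
  proof (rule subspaceI)
    have "?k 0 s = 0" for s
      using scale[of s 0 0] by (simp only: scaleR_zero_left zero_power2 mult_zero_left)
    then show "0 \<in> interp_half D N"
      unfolding interp_half_def mem_Collect_eq by (simp only: integrable_zero)
    show "c *\<^sub>R u \<in> interp_half D N" if "u \<in> interp_half D N" for c u
    proof -
      have "integrable half_line (\<lambda>s. c\<^sup>2 * ?k u s)"
        using that unfolding interp_half_def mem_Collect_eq by (intro integrable_mult_right)
      then show ?thesis
        unfolding interp_half_def mem_Collect_eq by (simp only: scale)
    qed
    show "u + v \<in> interp_half D N" if "u \<in> interp_half D N" "v \<in> interp_half D N" for u v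
    proof -
      have "integrable half_line (\<lambda>s. 2 * ?k u s + 2 * ?k v s)"
        using that unfolding interp_half_def mem_Collect_eq
        by (intro Bochner_Integration.integrable_add integrable_mult_right)
      moreover have "norm (?k (u + v) s) \<le> norm (2 * ?k u s + 2 * ?k v s)" for s
        using par[of s u v] nn[of s "u + v"] nn[of s "u - v"] unfolding real_norm_def by linarith
      ultimately show ?thesis
        unfolding interp_half_def mem_Collect_eq
        by (rule Bochner_Integration.integrable_bound[OF _ meas AE_I2])
    qed
  qed
  have sq: "(interp_half_norm D N u)\<^sup>2 = 2 / pi * (\<integral>s. ?k u s \<partial>half_line)" for u
    unfolding interp_half_norm_def using integral_nonneg_AE[OF AE_I2[OF nn]]
    by (intro real_sqrt_pow2 mult_nonneg_nonneg) auto
  show "nonneg_quadratic_on (interp_half D N) (\<lambda>u. (interp_half_norm D N u)\<^sup>2)"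
    unfolding nonneg_quadratic_on_def
  proof (intro conjI ballI allI)
    show "(interp_half_norm D N (c *\<^sub>R u))\<^sup>2 = c\<^sup>2 * (interp_half_norm D N u)\<^sup>2" for c u
      unfolding sq scale integral_mult_right_zero by (rule mult.left_commute)
    fix u v assume u: "u \<in> interp_half D N" and v: "v \<in> interp_half D N"
    \<comment> \<open>A nonintegrable function would have integral 0 by default; the subspace
      property excludes this for \<open>u + v\<close> and \<open>u - v\<close>.\<close>
    then have int: "integrable half_line (?k w)" if "w \<in> {u, v, u + v, u - v}" for w
      using that subspace_add[OF sub u v] subspace_diff[OF sub u v] by (auto simp: interp_half_def)
    have "(\<integral>s. ?k (u + v) s \<partial>half_line) + (\<integral>s. ?k (u - v) s \<partial>half_line)
        = (\<integral>s. ?k (u + v) s + ?k (u - v) s \<partial>half_line)"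
      by (intro Bochner_Integration.integral_add[symmetric] int) auto
    also have "\<dots> = (\<integral>s. 2 * ?k u s + 2 * ?k v s \<partial>half_line)"
      unfolding par ..
    also have "\<dots> = 2 * (\<integral>s. ?k u s \<partial>half_line) + 2 * (\<integral>s. ?k v s \<partial>half_line)"
      by (subst Bochner_Integration.integral_add) (auto intro!: int integrable_mult_right simp del: times_divide_eq_right)
    finally have "2 / pi * ((\<integral>s. ?k (u + v) s \<partial>half_line) + (\<integral>s. ?k (u - v) s \<partial>half_line))
        = 2 / pi * (2 * (\<integral>s. ?k u s \<partial>half_line) + 2 * (\<integral>s. ?k v s \<partial>half_line))"
      by (rule arg_cong)
    then show "(interp_half_norm D N (u + v))\<^sup>2 + (interp_half_norm D N (u - v))\<^sup>2
        = 2 * (interp_half_norm D N u)\<^sup>2 + 2 * (interp_half_norm D N v)\<^sup>2"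
      unfolding sq by (simp only: distrib_left mult.left_commute[of "2 / pi"])
  qed simp
qed

section \<open>The Sobolev spaces and the half-order space with zero initial value\<close>

lemma subspace_H1: "subspace H1"
proof (rule subspaceI)
  show "0 \<in> H1"
    using has_weak_derivative_zero unfolding H1_def by blast
  show "u + v \<in> H1" if "u \<in> H1" "v \<in> H1" for u v :: "'a L2"
    using that has_weak_derivative_add[of u _ v] unfolding H1_def by blast
  show "c *\<^sub>R u \<in> H1" if "u \<in> H1" for c and u :: "'a L2"
    using that has_weak_derivative_scaleR[of u _ c] unfolding H1_def by blast
qed

text \<open>By uniqueness the description selects a linear map on \<open>H1\<close>, so the squared
  norm is a sum of two squared \<open>L2\<close> norms of linear maps.\<close>

lemma nonneg_quadratic_on_H1_norm: "nonneg_quadratic_on H1 (\<lambda>u. (H1_norm u)\<^sup>2)"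
proof -
  let ?d = "\<lambda>u. THE g. has_weak_derivative u g"
  have d: "?d u = g" if "has_weak_derivative u g" for u g :: "'a L2"
    using that has_weak_derivative_unique by blast
  have "nonneg_quadratic_on H1 (\<lambda>u :: 'a L2. (norm u)\<^sup>2 + (norm (?d u))\<^sup>2)"
    by (intro nonneg_quadratic_on_add nonneg_quadratic_on_norm_sq[where f = "\<lambda>u. u"]
        nonneg_quadratic_on_norm_sq[where f = ?d] subspace_H1)
       (auto simp: H1_def d intro!: d has_weak_derivative_add has_weak_derivative_scaleR)
  then show ?thesis by (simp add: H1_norm_def)
qed

lemma subspace_H1_0: "subspace H1_0"
proof (rule subspaceI)
  have "represents (\<lambda>t. 0) (0 :: 'a L2)"
    using represents_scaleR[OF represents_rep, of 0 "0 :: 'a L2"] by simp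
  then show "0 \<in> (H1_0 :: 'a L2 set)"
    using subspace_0[OF subspace_H1] by (auto simp: H1_0_def intro!: exI[of _ "\<lambda>t. 0"])
next
  fix u v :: "'a L2" assume "u \<in> H1_0" "v \<in> H1_0"
  then obtain f g where "u \<in> H1" "continuous_on {0..} f" "represents f u" "f 0 = 0"
    "v \<in> H1" "continuous_on {0..} g" "represents g v" "g 0 = 0"
    unfolding H1_0_def by auto
  then show "u + v \<in> H1_0"
    unfolding H1_0_def
    by (auto intro!: subspace_add[OF subspace_H1] exI[of _ "\<lambda>t. f t + g t"] continuous_intros represents_add)
next
  fix c and u :: "'a L2" assume "u \<in> H1_0"
  then obtain f where "u \<in> H1" "continuous_on {0..} f" "represents f u" "f 0 = 0"
    unfolding H1_0_def by auto
  then show "c *\<^sub>R u \<in> H1_0"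
    unfolding H1_0_def
    by (auto intro!: subspace_scale[OF subspace_H1] exI[of _ "\<lambda>t. c *\<^sub>R f t"] continuous_intros represents_scaleR)
qed

lemma nonneg_quadratic_on_H1_0_norm: "nonneg_quadratic_on H1_0 (\<lambda>u. (H1_norm u)\<^sup>2)"
  by (rule nonneg_quadratic_on_subset[OF nonneg_quadratic_on_H1_norm]) (auto simp: H1_0_def)

lemma H_half_00_quadratic:
  "subspace H_half_00" "nonneg_quadratic_on H_half_00 (\<lambda>u. (H_half_00_norm u)\<^sup>2)"
  unfolding H_half_00_def H_half_00_norm_def
  by (rule interp_half_quadratic[OF subspace_H1_0 nonneg_quadratic_on_H1_0_norm])+

section \<open>The \<open>V\<close>-valued part and the space-time form\<close>

context
  fixes \<iota> :: "'v::{real_inner,banach,second_countable_topology} \<Rightarrow>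
              'h::{real_inner,banach,second_countable_topology}"
  assumes \<iota>: "bounded_linear \<iota>" "inj \<iota>"
begin

text \<open>Injectivity of \<open>\<iota>\<close> makes any two candidates agree almost everywhere,
  which settles the description in \<open>V_part\<close>.\<close>

lemma V_part_eqI:
  assumes "represents (\<lambda>t. \<iota> (rep_L2 g t)) u"
  shows "V_part \<iota> u = g"
  unfolding V_part_def
proof (rule the_equality, rule assms)
  fix g' assume "represents (\<lambda>t. \<iota> (rep_L2 g' t)) u"
  with assms have "AE t in half_line. \<iota> (rep_L2 g' t) = \<iota> (rep_L2 g t)"
    unfolding represents_def by eventually_elim simp
  then show "g' = g"
    by (intro L2_eqI) (simp add: inj_eq[OF \<iota>(2)])
qed

lemma represents_V_part:
  assumes "u \<in> L2_V \<iota>"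
  shows "represents (\<lambda>t. \<iota> (rep_L2 (V_part \<iota> u) t)) u"
proof -
  obtain g where "represents (\<lambda>t. \<iota> (rep_L2 g t)) u"
    using assms unfolding L2_V_def by blast
  then show ?thesis using V_part_eqI by simp
qed

lemma represents_V_add:
  assumes "represents (\<lambda>t. \<iota> (rep_L2 f t)) u" "represents (\<lambda>t. \<iota> (rep_L2 g t)) v"
  shows "represents (\<lambda>t. \<iota> (rep_L2 (f + g) t)) (u + v)"
  using represents_add[OF assms] rep_L2_add[of f g] unfolding represents_def
  by eventually_elim (simp add: linear_add[OF bounded_linear.linear[OF \<iota>(1)]])

lemma represents_V_scaleR:
  assumes "represents (\<lambda>t. \<iota> (rep_L2 f t)) u"
  shows "represents (\<lambda>t. \<iota> (rep_L2 (c *\<^sub>R f) t)) (c *\<^sub>R u)"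
  using represents_scaleR[OF assms, of c] rep_L2_scaleR[of c f] unfolding represents_def
  by eventually_elim (simp add: linear_scale[OF bounded_linear.linear[OF \<iota>(1)]])

lemma V_part_add: "u \<in> L2_V \<iota> \<Longrightarrow> v \<in> L2_V \<iota> \<Longrightarrow> V_part \<iota> (u + v) = V_part \<iota> u + V_part \<iota> v"
  by (rule V_part_eqI[OF represents_V_add[OF represents_V_part represents_V_part]])

lemma V_part_scaleR: "u \<in> L2_V \<iota> \<Longrightarrow> V_part \<iota> (c *\<^sub>R u) = c *\<^sub>R V_part \<iota> u"
  by (rule V_part_eqI[OF represents_V_scaleR[OF represents_V_part]])

lemma subspace_L2_V: "subspace (L2_V \<iota>)"
proof (rule subspaceI)
  have "represents (\<lambda>t. \<iota> (rep_L2 0 t)) 0"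
    using rep_L2_scaleR[of 0 "0 :: 'v L2"] rep_L2_scaleR[of 0 "0 :: 'h L2"]
    unfolding represents_def
    by eventually_elim (simp add: linear_0[OF bounded_linear.linear[OF \<iota>(1)]])
  then show "0 \<in> L2_V \<iota>" by (auto simp: L2_V_def)
next
  show "u + v \<in> L2_V \<iota>" if "u \<in> L2_V \<iota>" "v \<in> L2_V \<iota>" for u v
    using represents_V_add[OF represents_V_part represents_V_part, OF that]
    unfolding L2_V_def by blast
  show "c *\<^sub>R u \<in> L2_V \<iota>" if "u \<in> L2_V \<iota>" for c u
    using represents_V_scaleR[OF represents_V_part[OF that], of c]
    unfolding L2_V_def by blast
qed

lemma nonneg_quadratic_on_V_part: "nonneg_quadratic_on (L2_V \<iota>) (\<lambda>u. (norm (V_part \<iota> u))\<^sup>2)"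
  by (rule nonneg_quadratic_on_norm_sq[OF subspace_L2_V V_part_add V_part_scaleR])

text \<open>Supplies the Hilbert norm on which the constant in \<open>galerkin_quasi_optimal\<close>
  depends.\<close>

lemma X_space_quadratic:
  "subspace (X_space \<iota>)" "nonneg_quadratic_on (X_space \<iota>) (\<lambda>u. (X_norm \<iota> u)\<^sup>2)"
proof -
  show "subspace (X_space \<iota>)"
    unfolding X_space_def by (intro subspace_inter H_half_00_quadratic subspace_L2_V)
  have "nonneg_quadratic_on (X_space \<iota>) (\<lambda>u. (H_half_00_norm u)\<^sup>2 + (norm (V_part \<iota> u))\<^sup>2)"
    unfolding X_space_def
    by (intro nonneg_quadratic_on_add nonneg_quadratic_on_subset[OF H_half_00_quadratic(2)]
        nonneg_quadratic_on_subset[OF nonneg_quadratic_on_V_part]) auto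
  then show "nonneg_quadratic_on (X_space \<iota>) (\<lambda>u. (X_norm \<iota> u)\<^sup>2)"
    by (simp add: X_norm_def)
qed

text \<open>Both summands of the integrand are integrable, the second because it is bounded by
  \<open>norm A\<close> times a sum of squared norms. So the form splits into an inner product in
  \<open>L2\<close> and the integral \<open>a\<close>, each bilinear.\<close>

lemma bilinear_on_bilinear_form:
  assumes Dp: "is_half_deriv_plus Dp" and Dm: "is_half_deriv_minus Dm"
  shows "bilinear_on (X_space \<iota>) (Y_space \<iota>) (bilinear_form \<iota> A Dp Dm)"
proof -
  define a where "a f g = (\<integral>t. blinfun_apply (blinfun_apply A (rep_L2 f t)) (rep_L2 g t) \<partial>half_line)"
    for f g :: "'v L2"
  have [measurable]: "(\<lambda>t. blinfun_apply (blinfun_apply A (rep_L2 f t)) (rep_L2 g t)) \<in> borel_measurable half_line"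
    for f g :: "'v L2"
    by (rule borel_measurable_continuous_Pair[where H = "\<lambda>x y. blinfun_apply (blinfun_apply A x) y"])
       (auto intro!: continuous_intros)
  have int: "integrable half_line (\<lambda>t. blinfun_apply (blinfun_apply A (rep_L2 f t)) (rep_L2 g t))"
    for f g :: "'v L2"
  proof -
    have dom: "integrable half_line (\<lambda>t. norm A * ((norm (rep_L2 f t))\<^sup>2 + (norm (rep_L2 g t))\<^sup>2))"
      using square_integrable_rep[of f] square_integrable_rep[of g]
      by (auto simp: square_integrable_def)
    have bound: "norm (blinfun_apply (blinfun_apply A x) y) \<le> norm (norm A * ((norm x)\<^sup>2 + (norm y)\<^sup>2))" for x y
    proof -
      have "norm (blinfun_apply (blinfun_apply A x) y) \<le> norm (blinfun_apply A x) * norm y"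
        by (rule norm_blinfun)
      also have "\<dots> \<le> norm A * norm x * norm y"
        by (intro mult_right_mono norm_blinfun) simp
      also have "\<dots> \<le> norm A * ((norm x)\<^sup>2 + (norm y)\<^sup>2)"
        unfolding mult.assoc by (intro mult_left_mono mult_le_sum_squares norm_ge_zero)
      finally show ?thesis by simp
    qed
    show ?thesis
      by (rule Bochner_Integration.integrable_bound[OF dom]) (measurable, intro AE_I2 bound)
  qed
  have a_add: "a (f + g) h = a f h + a g h" "a h (f + g) = a h f + a h g" for f g h
  proof -
    have "a (f + g) h = (\<integral>t. blinfun_apply (blinfun_apply A (rep_L2 f t)) (rep_L2 h t)
        + blinfun_apply (blinfun_apply A (rep_L2 g t)) (rep_L2 h t) \<partial>half_line)"
      unfolding a_def using rep_L2_add[of f g]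
      by (intro integral_cong_AE) (auto simp: blinfun.bilinear_simps)
    then show "a (f + g) h = a f h + a g h"
      unfolding a_def by (simp add: Bochner_Integration.integral_add int)
    have "a h (f + g) = (\<integral>t. blinfun_apply (blinfun_apply A (rep_L2 h t)) (rep_L2 f t)
        + blinfun_apply (blinfun_apply A (rep_L2 h t)) (rep_L2 g t) \<partial>half_line)"
      unfolding a_def using rep_L2_add[of f g]
      by (intro integral_cong_AE) (auto simp: blinfun.bilinear_simps)
    then show "a h (f + g) = a h f + a h g"
      unfolding a_def by (simp add: Bochner_Integration.integral_add int)
  qed
  have a_scale: "a (c *\<^sub>R f) h = c * a f h" "a h (c *\<^sub>R f) = c * a h f" for c f h
  proof -
    have "a (c *\<^sub>R f) h = (\<integral>t. c * blinfun_apply (blinfun_apply A (rep_L2 f t)) (rep_L2 h t) \<partial>half_line)"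
      unfolding a_def using rep_L2_scaleR[of c f]
      by (intro integral_cong_AE) (auto simp: blinfun.bilinear_simps)
    then show "a (c *\<^sub>R f) h = c * a f h" unfolding a_def by simp
    have "a h (c *\<^sub>R f) = (\<integral>t. c * blinfun_apply (blinfun_apply A (rep_L2 h t)) (rep_L2 f t) \<partial>half_line)"
      unfolding a_def using rep_L2_scaleR[of c f]
      by (intro integral_cong_AE) (auto simp: blinfun.bilinear_simps)
    then show "a h (c *\<^sub>R f) = c * a h f" unfolding a_def by simp
  qed
  have B: "bilinear_form \<iota> A Dp Dm w v = inner (Dp w) (Dm v) + a (V_part \<iota> w) (V_part \<iota> v)" for w v
    unfolding bilinear_form_def a_def inner_L2_rep
    by (intro Bochner_Integration.integral_add int square_integrable_inner square_integrable_rep)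
  have Dp: "u \<in> H_half_00 \<Longrightarrow> v \<in> H_half_00 \<Longrightarrow> Dp (u + v) = Dp u + Dp v"
    "u \<in> H_half_00 \<Longrightarrow> Dp (c *\<^sub>R u) = c *\<^sub>R Dp u" for u v c
    using Dp unfolding is_half_deriv_plus_def bounded_linear_wrt_def by blast+
  have Dm: "u \<in> H_half \<Longrightarrow> v \<in> H_half \<Longrightarrow> Dm (u + v) = Dm u + Dm v"
    "u \<in> H_half \<Longrightarrow> Dm (c *\<^sub>R u) = c *\<^sub>R Dm u" for u v c
    using Dm unfolding is_half_deriv_minus_def bounded_linear_wrt_def by blast+
  show ?thesis
    unfolding bilinear_on_def B X_space_def Y_space_def
    by (simp add: Dp Dm V_part_add V_part_scaleR a_add a_scale inner_simps algebra_simps)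
qed

end

section \<open>Solvability, regular stiffness matrices and the error estimate for the space-time
  form\<close>

theorem proposition4p1:
  fixes \<iota> :: "'v::{real_inner,banach,second_countable_topology} \<Rightarrow>
              'h::{real_inner,banach,second_countable_topology}"
    and A :: "'v \<Rightarrow>\<^sub>L 'v \<Rightarrow>\<^sub>L real"
    and lam_minus lam_plus \<gamma> :: real
    and Dp Dm :: "'h L2 \<Rightarrow> 'h L2"
    and B :: "'h L2 \<Rightarrow> 'h L2 \<Rightarrow> real"
    and Xl Yl :: "nat \<Rightarrow> 'h L2 set"
    and N :: "nat \<Rightarrow> nat"
  assumes embedding: "bounded_linear \<iota>" "inj \<iota>" "closure (range \<iota>) = UNIV"
    and A_selfadjoint: "\<And>v w. blinfun_apply (blinfun_apply A v) w = blinfun_apply (blinfun_apply A w) v"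
    and lam: "0 < lam_minus" "lam_minus \<le> lam_plus"
    and A_coercive: "\<And>v. blinfun_apply (blinfun_apply A v) v \<ge> lam_minus * (norm v)\<^sup>2"
    and A_bounded: "\<And>v w. \<bar>blinfun_apply (blinfun_apply A v) w\<bar> \<le> lam_plus * norm v * norm w"
    and half_derivs: "is_half_deriv_plus Dp" "is_half_deriv_minus Dm"
    and B_def: "B = bilinear_form \<iota> A Dp Dm"
    and Xl_subspace: "\<And>l. subspace (Xl l)" "\<And>l. Xl l \<subseteq> X_space \<iota>"
    and Yl_subspace: "\<And>l. subspace (Yl l)" "\<And>l. Yl l \<subseteq> Y_space \<iota>"
    and Xl_dim: "\<And>l. \<exists>b. finite b \<and> span b = Xl l" "\<And>l. dim (Xl l) = N l"
    and Yl_dim: "\<And>l. \<exists>b. finite b \<and> span b = Yl l" "\<And>l. dim (Yl l) = N l"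
    and nested: "\<And>l. Xl l \<subseteq> Xl (Suc l)" "\<And>l. Yl l \<subseteq> Yl (Suc l)"
    and Xl_dense: "dense_wrt (X_space \<iota>) (X_norm \<iota>) (\<Union>l. Xl l)"
    and Yl_dense: "dense_wrt (Y_space \<iota>) (Y_norm \<iota>) (\<Union>l. Yl l)"
    and \<gamma>_pos: "\<gamma> > 0"
    and inf_sup: "\<And>l. (INF w\<in>Xl l - {0}. SUP v\<in>Yl l - {0}.
                         ereal (B w v / (X_norm \<iota> w * Y_norm \<iota> v))) \<ge> ereal \<gamma>"
  shows "(\<forall>F l. bounded_linear_wrt (Y_space \<iota>) (Y_norm \<iota>) F \<longrightarrow>
            (\<exists>!ul. ul \<in> Xl l \<and> (\<forall>vl \<in> Yl l. B ul vl = F vl)))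
       \<and> (\<forall>l \<phi> \<psi>. is_basis (N l) \<phi> (Xl l) \<and> is_basis (N l) \<psi> (Yl l) \<longrightarrow>
            invertible_mat (stiffness_matrix (N l) B \<phi> \<psi>))
       \<and> (\<forall>F l u ul C. bounded_linear_wrt (Y_space \<iota>) (Y_norm \<iota>) F \<longrightarrow>
            u \<in> X_space \<iota> \<longrightarrow> (\<forall>v \<in> Y_space \<iota>. B u v = F v) \<longrightarrow>
            ul \<in> Xl l \<longrightarrow> (\<forall>vl \<in> Yl l. B ul vl = F vl) \<longrightarrow>
            (\<forall>w \<in> X_space \<iota>. \<forall>v \<in> Y_space \<iota>. \<bar>B w v\<bar> \<le> C * X_norm \<iota> w * Y_norm \<iota> v) \<longrightarrow>
            X_norm \<iota> (u - ul) \<le> C / \<gamma> * (INF vl \<in> Xl l. X_norm \<iota> (u - vl)))"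
proof -
  let ?X = "X_space \<iota>" and ?Y = "Y_space \<iota>" and ?NX = "X_norm \<iota>" and ?NY = "Y_norm \<iota>"
  have X: "subspace ?X" "nonneg_quadratic_on ?X (\<lambda>u. (?NX u)\<^sup>2)"
    by (rule X_space_quadratic[OF embedding(1,2)])+
  have NX: "0 \<le> ?NX u" and NY: "0 \<le> ?NY u" for u
    by (simp_all add: X_norm_def Y_norm_def)
  have B: "bilinear_on ?X ?Y B"
    unfolding B_def by (rule bilinear_on_bilinear_form[OF embedding(1,2) half_derivs])
  have Bl: "bilinear_on (Xl l) (Yl l) B" for l
    by (rule bilinear_on_subset[OF B Xl_subspace(2) Yl_subspace(2)])
  have infsup: "inf_sup_on (Xl l) ?NX (Yl l) ?NY B \<gamma>" for l
    unfolding inf_sup_on_def by (rule inf_sup)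
  have inj: "w = 0" if w: "w \<in> Xl l" and 0: "\<And>v. v \<in> Yl l \<Longrightarrow> B w v = 0" for w l
  proof (rule ccontr)
    assume "w \<noteq> 0"
    \<comment> \<open>At \<open>c = 0\<close> the inf-sup condition yields a test function with
      \<open>B w v > 0\<close>.\<close>
    then obtain v where "v \<in> Yl l" "0 * ?NX w * ?NY v < B w v"
      using inf_sup_onD[OF infsup order_refl \<gamma>_pos w _ NX NY] by blast
    with 0 show False by simp
  qed
  have unique: "\<exists>!ul. ul \<in> Xl l \<and> (\<forall>vl\<in>Yl l. B ul vl = F vl)"
    if F: "bounded_linear_wrt ?Y ?NY F" for F :: "'h L2 \<Rightarrow> real" and l
  proof -
    obtain b where b: "finite b" "span b = Xl l" using Xl_dim(1) by blast
    obtain d where d: "finite d" "span d = Yl l" using Yl_dim(1) by blast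
    show ?thesis
    proof (rule galerkin_unique_solution[OF Bl b Xl_dim(2) d Yl_dim(2)])
      show "w = 0" if "w \<in> Xl l" "\<And>v. v \<in> Yl l \<Longrightarrow> B w v = 0" for w
        using that by (rule inj)
      show "F (u + v) = F u + F v" if "u \<in> Yl l" "v \<in> Yl l" for u v
        using F that Yl_subspace(2)[of l] unfolding bounded_linear_wrt_def by blast
      show "F (c *\<^sub>R u) = c * F u" if "u \<in> Yl l" for c u
        using F that Yl_subspace(2)[of l] unfolding bounded_linear_wrt_def real_scaleR_def by blast
    qed
  qed
  have invertible: "invertible_mat (stiffness_matrix (N l) B \<phi> \<psi>)"
    if "is_basis (N l) \<phi> (Xl l)" "is_basis (N l) \<psi> (Yl l)" for l \<phi> \<psi>
    by (rule stiffness_matrix_invertible[OF Bl that]) (rule inj)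
  have quasi: "?NX (u - ul) \<le> C / \<gamma> * (INF vl\<in>Xl l. ?NX (u - vl))"
    if u: "u \<in> ?X" "\<forall>v\<in>?Y. B u v = F v" and ul: "ul \<in> Xl l" "\<forall>vl\<in>Yl l. B ul vl = F vl"
      and C: "\<forall>w\<in>?X. \<forall>v\<in>?Y. \<bar>B w v\<bar> \<le> C * ?NX w * ?NY v" for F :: "'h L2 \<Rightarrow> real" and l u ul C
  proof (cases "\<forall>k. Xl k = {0}")
    case True
    \<comment> \<open>The dense union is \<open>{0}\<close>, so 0 approximates \<open>u\<close> to
      any accuracy. Both sides of the estimate are then 0, whatever the sign of
      \<open>C\<close>.\<close>
    have "?NX u < e" if "0 < e" for e
      using Xl_dense u(1) that True unfolding dense_wrt_def by fastforce
    then have "?NX u = 0" using NX[of u] by (metis less_irrefl order_le_less)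
    then show ?thesis using True ul(1) by simp
  next
    case False
    \<comment> \<open>The level \<open>k\<close> may differ from \<open>l\<close>, since
      \<open>w\<close> serves only to show \<open>\<gamma> \<le> C\<close>.\<close>
    then obtain k w where w: "w \<in> Xl k" "w \<noteq> 0"
      using subspace_0[OF Xl_subspace(1)] by blast
    have wX: "w \<in> ?X" using w Xl_subspace(2) by blast
    have pos: "0 < ?NX w"
      using inf_sup_onD[OF infsup order_refl \<gamma>_pos w NX NY] by blast
    have "\<gamma> * ?NX w \<le> C * ?NX w"
    proof (rule inf_sup_on_le[OF infsup \<gamma>_pos w NX NY])
      show "B w v \<le> C * ?NX w * ?NY v" if "v \<in> Yl k" for v
      proof -
        have "v \<in> ?Y" using that Yl_subspace(2) by blast
        then have "\<bar>B w v\<bar> \<le> C * ?NX w * ?NY v" using C wX by blast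
        then show ?thesis by linarith
      qed
    qed
    then have \<gamma>C: "\<gamma> \<le> C" using pos by simp
    then have Cpos: "0 < C" using \<gamma>_pos by simp
    have "\<gamma> * ?NX (u - ul) \<le> C * ?NX (u - vl)" if vl: "vl \<in> Xl l" for vl
    proof (rule galerkin_quasi_optimal[OF X NX B Xl_subspace(1,2) Yl_subspace(2) _ NY infsup \<gamma>_pos \<gamma>C u(1) ul(1) _ vl])
      show "\<bar>B w v\<bar> \<le> C * ?NX w * ?NY v" if "w \<in> ?X" "v \<in> ?Y" for w v
        using C that by blast
      show "B ul v = B u v" if "v \<in> Yl l" for v
        using u(2) ul(2) that subsetD[OF Yl_subspace(2) that] by simp
    qed
    \<comment> \<open>The infimum is over a nonempty set, which contains \<open>ul\<close>, and
      \<open>0 < C\<close> allows the division.\<close>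
    then have "\<gamma> * ?NX (u - ul) / C \<le> (INF vl\<in>Xl l. ?NX (u - vl))"
      using ul(1) Cpos by (intro cINF_greatest) (auto simp: pos_divide_le_eq mult.commute)
    then show ?thesis
      using Cpos \<gamma>_pos by (simp add: field_simps)
  qed
  show ?thesis
    using unique invertible quasi by blast
qed

end
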